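(* Let $M$ be a compact $C^2$-submanifold of $\mathbb{R}^\ell$, $I:=[0,T)$, $\tau>0$ and $u_0\in M_\Delta$. Then the sequences $\{u_\tau^{(n)}\}_{n=0}^{N(I,\tau)}$ and $\{X_\tau^{(n)}\}_{n=0}^{N(I,\tau)-1}$ in the modified minimizing movement scheme $(\mathrm{MM}_{loc};\tau,u_0)$ are well-defined (each minimization problem in the scheme has a unique minimizer), and satisfy $$X_\tau^{(n)}\in-\tau P_{u_\tau^{(n)}}\partial TV_\Delta(u_\tau^{(n)}+X_\tau^{(n)}),\qquad \|X_\tau^{(n)}\|_{H_\Delta}\le\tau\,\mathrm{Lip}(TV_\Delta)$$ for all $n=0,\ldots,N(I,\tau)-1$.
   Context: Domain and partition. $\Omega\subset\mathbb{R}^k$ ($k\ge1$) is a bounded domain with Lipschitz boundary, $\mathcal{L}^k$ is Lebesgue measure, $\mathcal{H}^{k-1}$ is Hausdorff measure. $\Omega_\Delta=\{\Omega_\alpha\}_{\alpha\in\Delta}$ ($\Delta$ a finite index set) is a fixed rectangular partition of $\Omega$: $\mathcal{L}^k(\Omega\setminus\bigcup_\alpha\Omega_\alpha)=0$; $\mathcal{L}^k(\Omega_\alpha\cap\Omega_\beta)=0$ for $\alpha\ne\beta$; and each $\Omega_\alpha=R_\alpha\cap\Omega$ with $R_\alpha=\prod_{j=1}^k(a_j,b_j)$ for some $a_j<b_j$ (depending on $\alpha$). The edge set is $e(\Delta):=\{\{\alpha,\beta\}\subset\Delta : \alpha\neq\beta,\ \mathcal{H}^{k-1}(\overline{\partial\Omega_\alpha\cap\partial\Omega_\beta})\ne0\}$,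 and $E_{\{\alpha,\beta\}}:=\overline{\partial\Omega_\alpha\cap\partial\Omega_\beta}$. Manifold. $M\subset\mathbb{R}^\ell$ ($\ell\ge2$); $\pi_p$ is the orthogonal projection of $\mathbb{R}^\ell$ onto $T_pM$; $\mathrm{II}_p:T_pM\times T_pM\to T_p^\perp M$ is the second fundamental form. The exponential map is $\exp_p(V):=\gamma(1)$, where $\gamma:[0,\infty)\to M$ is the unique solution of $\gamma''=\mathrm{II}_\gamma(\gamma',\gamma')$, $\gamma(0)=p$, $\gamma'(0)=V\in T_pM$ (this existence and uniqueness is taken as known for compact $M$). Function spaces. $H_\Delta$ is the space of $U\in L^2(\Omega;\mathbb{R}^\ell)$ constant on each $\Omega_\alpha$ (value $U^\alpha$), with the $L^2(\Omega;\mathbb{R}^\ell)$ inner product. $M_\Delta\subset H_\Delta$ is the set of those with values in $M$. For $u\in M_\Delta$, $T_uM_\Delta:=\{X\in H_\Delta: X^\alpha\in T_{u^\alpha}M\ \forall\alpha\}$; $P_u:H_\Delta\to T_uM_\Delta$ is the orthogonal projection $P_uX(x)=\pi_{u(x)}(X(x))$; $\mathrm{Exp}_u:T_uM_\Delta\to M_\Delta$ is $\mathrm{Exp}_u(X)(x)=\exp_{u(x)}(X(x))$. Discrete total variation. $TV_\Delta(u):=\sum_{\{\alpha,\beta\}\in e(\Delta)}\|u^\alpha-u^\beta\|_{\mathbb{R}^\ell}\mathcal{H}^{k-1}(E_{\{\alpha,\beta\}})$ for $u\in H_\Delta$, with Lipschitz constant $\mathrm{Lip}(TV_\Delta):=\sup_{u\ne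 w\in H_\Delta}|TV_\Delta(u)-TV_\Delta(w)|/\|u-w\|_{H_\Delta}<\infty$. Its subdifferential in $H_\Delta$ is $\partial TV_\Delta(u):=\{\zeta\in H_\Delta:\langle\zeta,w-u\rangle_{H_\Delta}+TV_\Delta(u)\le TV_\Delta(w)\ \forall w\in H_\Delta\}$. Scheme. $N(I,\tau)$ is the minimal integer greater than $T/\tau$. The modified minimizing movement scheme $(\mathrm{MM}_{loc};\tau,u_0)$: $u_\tau^{(0)}:=u_0$ and, for $1\le n\le N(I,\tau)$, let $X_\tau^{(n-1)}$ be the minimizer over $X\in T_{u_\tau^{(n-1)}}M_\Delta$ of $\tau\,TV_\Delta(u_\tau^{(n-1)}+X)+\frac12\|X\|_{H_\Delta}^2$, and set $u_\tau^{(n)}:=\mathrm{Exp}_{u_\tau^{(n-1)}}(X_\tau^{(n-1)})$. *)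

theory Defs
  imports "HOL-Analysis.Analysis"
begin

section \<open>Hausdorff measure\<close>

text \<open>
  The exponent is a natural number so that, for \<open>m = 0\<close>, a singleton has weight \<open>0 ^ 0 = 1\<close> and the
  counting measure is obtained (\<open>0 powr 0\<close> would be \<open>0\<close>). The covering sets are required to be
  bounded because \<^const>\<open>diameter\<close> is only meaningful for bounded sets. The factor
  \<^const>\<open>unit_ball_vol\<close> gives the normalisation for which the \<open>m\<close>-dimensional measure agrees with
  Lebesgue measure on \<open>m\<close>-dimensional space.
\<close>

definition hausdorff_weight :: "nat \<Rightarrow> 'a::metric_space set \<Rightarrow> ennreal" where
  "hausdorff_weight m C =
     (if C = {} then 0 else ennreal (unit_ball_vol (real m) * (diameter C / 2) ^ m))"

definition hausdorff_premeasure :: "nat \<Rightarrow> real \<Rightarrow> 'a::metric_space set \<Rightarrow> ennreal" where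
  "hausdorff_premeasure m \<delta> A =
     (INF C\<in>{C :: nat \<Rightarrow> 'a set. A \<subseteq> (\<Union>i. C i) \<and> (\<forall>i. bounded (C i) \<and> diameter (C i) \<le> \<delta>)}.
        \<Sum>i. hausdorff_weight m (C i))"

definition hausdorff_measure :: "nat \<Rightarrow> 'a::metric_space set \<Rightarrow> ennreal" where
  "hausdorff_measure m A = (SUP \<delta>\<in>{0<..}. hausdorff_premeasure m \<delta> A)"


section \<open>Domains and rectangular partitions\<close>

text \<open>
  Near every boundary point the set is the part above a Lipschitz graph; \<open>\<nu>\<close> is the direction of
  the vertical axis and \<open>g\<close> is a function on the hyperplane orthogonal to it.
\<close>

definition lipschitz_boundary :: "'a::euclidean_space set \<Rightarrow> bool" where
  "lipschitz_boundary \<Omega> \<longleftrightarrow>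
     (\<forall>x\<in>frontier \<Omega>. \<exists>r>0. \<exists>\<nu> g L. norm \<nu> = 1 \<and> L-lipschitz_on {w. \<nu> \<bullet> w = 0} g \<and>
        (\<forall>y\<in>ball x r. y \<in> \<Omega> \<longleftrightarrow> g (y - (\<nu> \<bullet> y) *\<^sub>R \<nu>) < \<nu> \<bullet> y))"

definition bounded_lipschitz_domain :: "'a::euclidean_space set \<Rightarrow> bool" where
  "bounded_lipschitz_domain \<Omega> \<longleftrightarrow>
     open \<Omega> \<and> connected \<Omega> \<and> \<Omega> \<noteq> {} \<and> bounded \<Omega> \<and> lipschitz_boundary \<Omega>"

definition rectangular_partition ::
    "(real^'k) set \<Rightarrow> 'i set \<Rightarrow> ('i \<Rightarrow> (real^'k) set) \<Rightarrow> bool" where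
  "rectangular_partition \<Omega> \<Delta> C \<longleftrightarrow>
     finite \<Delta> \<and>
     emeasure lebesgue (\<Omega> - (\<Union>\<alpha>\<in>\<Delta>. C \<alpha>)) = 0 \<and>
     (\<forall>\<alpha>\<in>\<Delta>. \<forall>\<beta>\<in>\<Delta>. \<alpha> \<noteq> \<beta> \<longrightarrow> emeasure lebesgue (C \<alpha> \<inter> C \<beta>) = 0) \<and>
     (\<forall>\<alpha>\<in>\<Delta>. \<exists>a b. (\<forall>j. a $ j < b $ j) \<and> C \<alpha> = box a b \<inter> \<Omega>)"

definition interface :: "('i \<Rightarrow> (real^'k) set) \<Rightarrow> 'i set \<Rightarrow> (real^'k) set" where
  "interface C e = closure (\<Inter>\<alpha>\<in>e. frontier (C \<alpha>))"

definition edges :: "'i set \<Rightarrow> ('i \<Rightarrow> (real^'k) set) \<Rightarrow> 'i set set" where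
  "edges \<Delta> C = {{\<alpha>, \<beta>} | \<alpha> \<beta>. \<alpha> \<in> \<Delta> \<and> \<beta> \<in> \<Delta> \<and> \<alpha> \<noteq> \<beta> \<and>
      hausdorff_measure (CARD('k) - 1) (interface C {\<alpha>, \<beta>}) \<noteq> 0}"


section \<open>Submanifolds of Euclidean space\<close>

definition C1_on :: "'a::real_normed_vector set \<Rightarrow> ('a \<Rightarrow> 'b::real_normed_vector)
    \<Rightarrow> ('a \<Rightarrow> 'a \<Rightarrow>\<^sub>L 'b) \<Rightarrow> bool" where
  "C1_on U f f' \<longleftrightarrow>
     (\<forall>x\<in>U. (f has_derivative blinfun_apply (f' x)) (at x)) \<and> continuous_on U f'"

definition C2_on :: "'a::real_normed_vector set \<Rightarrow> ('a \<Rightarrow> 'b::real_normed_vector) \<Rightarrow> bool" where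
  "C2_on U f \<longleftrightarrow> (\<exists>f' f''. C1_on U f f' \<and> C1_on U f' f'')"

definition C2_submanifold :: "'a::euclidean_space set \<Rightarrow> bool" where
  "C2_submanifold M \<longleftrightarrow>
     (\<exists>m. \<forall>p\<in>M. \<exists>U (V :: 'a set) \<phi> \<psi> L. open U \<and> p \<in> U \<and> open V \<and>
        homeomorphism U V \<phi> \<psi> \<and> C2_on U \<phi> \<and> C2_on V \<psi> \<and>
        subspace L \<and> dim L = m \<and> \<phi> ` (U \<inter> M) = V \<inter> L)"

definition tangent_space :: "'a::euclidean_space set \<Rightarrow> 'a \<Rightarrow> 'a set" where
  "tangent_space M p =
     {v. \<exists>c :: real \<Rightarrow> 'a. \<exists>\<epsilon>>0. (\<forall>t. \<bar>t\<bar> < \<epsilon> \<longrightarrow> c t \<in> M) \<and> c 0 = p \<and>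
         (c has_vector_derivative v) (at 0)}"

definition orth_proj :: "'a::euclidean_space set \<Rightarrow> 'a \<Rightarrow> 'a" where
  "orth_proj S x = (THE y. y \<in> S \<and> x - y \<in> orthogonal_comp S)"

text \<open>
  The value at \<open>(V, W)\<close> is the normal component of the ambient directional derivative, along \<open>V\<close>,
  of any \<open>C\<^sup>1\<close> extension \<open>Y\<close> of \<open>W\<close> that is tangent to \<open>M\<close> near \<open>p\<close>. It does not depend on the
  choice of \<open>Y\<close> when \<open>M\<close> is a \<open>C\<^sup>2\<close>-submanifold and \<open>V\<close> is tangent to \<open>M\<close> at \<open>p\<close>.
\<close>

definition second_fundamental_form ::
    "'a::euclidean_space set \<Rightarrow> 'a \<Rightarrow> 'a \<Rightarrow> 'a \<Rightarrow> 'a" where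
  "second_fundamental_form M p V W =
     (THE n. \<exists>U Y Y'. open U \<and> p \<in> U \<and> C1_on U Y Y' \<and>
        (\<forall>q\<in>M \<inter> U. Y q \<in> tangent_space M q) \<and> Y p = W \<and>
        n = blinfun_apply (Y' p) V - orth_proj (tangent_space M p) (blinfun_apply (Y' p) V))"

definition geodesic :: "'a::euclidean_space set \<Rightarrow> 'a \<Rightarrow> 'a \<Rightarrow> (real \<Rightarrow> 'a) \<Rightarrow> bool" where
  "geodesic M p V \<gamma> \<longleftrightarrow>
     (\<forall>t\<ge>0. \<gamma> t \<in> M) \<and> \<gamma> 0 = p \<and>
     (\<exists>\<gamma>'. \<gamma>' 0 = V \<and>
        (\<forall>t\<ge>0. (\<gamma> has_vector_derivative \<gamma>' t) (at t within {0..}) \<and>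
           (\<gamma>' has_vector_derivative second_fundamental_form M (\<gamma> t) (\<gamma>' t) (\<gamma>' t))
             (at t within {0..})))"

text \<open>
  Curves are total functions here, so uniqueness is uniqueness of the restriction to \<open>[0, \<infinity>)\<close>.
  The property is a background fact for compact \<open>C\<^sup>2\<close>-submanifolds, and it is what makes the exponential
  map well-defined; the libraries do not provide it, so it enters as a hypothesis.
\<close>

definition unique_geodesics :: "'a::euclidean_space set \<Rightarrow> bool" where
  "unique_geodesics M \<longleftrightarrow>
     (\<forall>p\<in>M. \<forall>V\<in>tangent_space M p. \<exists>\<gamma>. geodesic M p V \<gamma> \<and>
        (\<forall>\<gamma>'. geodesic M p V \<gamma>' \<longrightarrow> (\<forall>t\<ge>0. \<gamma>' t = \<gamma> t)))"

definition exp_map :: "'a::euclidean_space set \<Rightarrow> 'a \<Rightarrow> 'a \<Rightarrow> 'a" where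
  "exp_map M p V = (THE q. \<exists>\<gamma>. geodesic M p V \<gamma> \<and> q = \<gamma> 1)"


section \<open>Spaces of piecewise constant functions\<close>

definition L2_space :: "'a::euclidean_space set \<Rightarrow> ('a \<Rightarrow> 'b::euclidean_space) set" where
  "L2_space \<Omega> = {U. U \<in> borel_measurable (lebesgue_on \<Omega>) \<and>
      integrable (lebesgue_on \<Omega>) (\<lambda>x. (norm (U x))\<^sup>2)}"

definition L2_inner :: "'a::euclidean_space set \<Rightarrow> ('a \<Rightarrow> 'b::euclidean_space) \<Rightarrow> ('a \<Rightarrow> 'b) \<Rightarrow> real" where
  "L2_inner \<Omega> U V = (LINT x|lebesgue_on \<Omega>. U x \<bullet> V x)"

definition L2_norm :: "'a::euclidean_space set \<Rightarrow> ('a \<Rightarrow> 'b::euclidean_space) \<Rightarrow> real" where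
  "L2_norm \<Omega> U = sqrt (L2_inner \<Omega> U U)"

text \<open>
  An element of \<open>H\<^sub>\<Delta>\<close>, a class of functions modulo equality almost everywhere on \<open>\<Omega>\<close>, is
  represented by its unique member that is constant on each cell \<open>C \<alpha>\<close> and vanishes off the union
  of the cells. The cells are open, hence pairwise disjoint, and they cover \<open>\<Omega>\<close> up to a null set,
  so equality of representatives is equality in \<open>L\<^sup>2\<close>.
\<close>

definition H_space ::
    "(real^'k) set \<Rightarrow> 'i set \<Rightarrow> ('i \<Rightarrow> (real^'k) set) \<Rightarrow> (real^'k \<Rightarrow> real^'l) set" where
  "H_space \<Omega> \<Delta> C = {U \<in> L2_space \<Omega>. (\<forall>\<alpha>\<in>\<Delta>. U constant_on C \<alpha>) \<and>
      (\<forall>x. x \<notin> (\<Union>\<alpha>\<in>\<Delta>. C \<alpha>) \<longrightarrow> U x = 0)}"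

definition cell_value :: "('i \<Rightarrow> (real^'k) set) \<Rightarrow> (real^'k \<Rightarrow> real^'l) \<Rightarrow> 'i \<Rightarrow> real^'l" where
  "cell_value C U \<alpha> = (THE c. U ` C \<alpha> = {c})"

definition M_space ::
    "(real^'k) set \<Rightarrow> 'i set \<Rightarrow> ('i \<Rightarrow> (real^'k) set) \<Rightarrow> (real^'l) set \<Rightarrow> (real^'k \<Rightarrow> real^'l) set" where
  "M_space \<Omega> \<Delta> C M = {u \<in> H_space \<Omega> \<Delta> C. \<forall>\<alpha>\<in>\<Delta>. \<forall>x\<in>C \<alpha>. u x \<in> M}"

definition TM_space ::
    "(real^'k) set \<Rightarrow> 'i set \<Rightarrow> ('i \<Rightarrow> (real^'k) set) \<Rightarrow> (real^'l) set \<Rightarrow> (real^'k \<Rightarrow> real^'l)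
     \<Rightarrow> (real^'k \<Rightarrow> real^'l) set" where
  "TM_space \<Omega> \<Delta> C M u =
     {X \<in> H_space \<Omega> \<Delta> C. \<forall>\<alpha>\<in>\<Delta>. \<forall>x\<in>C \<alpha>. X x \<in> tangent_space M (u x)}"

definition P_map ::
    "'i set \<Rightarrow> ('i \<Rightarrow> (real^'k) set) \<Rightarrow> (real^'l) set \<Rightarrow> (real^'k \<Rightarrow> real^'l)
     \<Rightarrow> (real^'k \<Rightarrow> real^'l) \<Rightarrow> real^'k \<Rightarrow> real^'l" where
  "P_map \<Delta> C M u X =
     (\<lambda>x. if x \<in> (\<Union>\<alpha>\<in>\<Delta>. C \<alpha>) then orth_proj (tangent_space M (u x)) (X x) else 0)"

definition Exp_map ::
    "'i set \<Rightarrow> ('i \<Rightarrow> (real^'k) set) \<Rightarrow> (real^'l) set \<Rightarrow> (real^'k \<Rightarrow> real^'l)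
     \<Rightarrow> (real^'k \<Rightarrow> real^'l) \<Rightarrow> real^'k \<Rightarrow> real^'l" where
  "Exp_map \<Delta> C M u X =
     (\<lambda>x. if x \<in> (\<Union>\<alpha>\<in>\<Delta>. C \<alpha>) then exp_map M (u x) (X x) else 0)"


section \<open>Discrete total variation\<close>

definition jump :: "('i \<Rightarrow> (real^'k) set) \<Rightarrow> (real^'k \<Rightarrow> real^'l) \<Rightarrow> 'i set \<Rightarrow> real" where
  "jump C U e =
     (THE r. \<exists>\<alpha> \<beta>. e = {\<alpha>, \<beta>} \<and> r = norm (cell_value C U \<alpha> - cell_value C U \<beta>))"

definition TV :: "'i set \<Rightarrow> ('i \<Rightarrow> (real^'k) set) \<Rightarrow> (real^'k \<Rightarrow> real^'l) \<Rightarrow> real" where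
  "TV \<Delta> C U =
     (\<Sum>e\<in>edges \<Delta> C. jump C U e * enn2real (hausdorff_measure (CARD('k) - 1) (interface C e)))"

text \<open>
  The supremum below is a genuine one for \<open>F = TV \<Delta> C\<close>: this is a seminorm on the nonzero
  finite-dimensional space \<open>H\<^sub>\<Delta>\<close>, so the set of quotients is nonempty and bounded above. Likewise the
  interfaces of a bounded Lipschitz domain have finite measure, so \<^const>\<open>enn2real\<close> loses nothing.
\<close>

definition lip_const ::
    "(real^'k) set \<Rightarrow> ((real^'k \<Rightarrow> real^'l) set) \<Rightarrow> ((real^'k \<Rightarrow> real^'l) \<Rightarrow> real) \<Rightarrow> real" where
  "lip_const \<Omega> H F =
     Sup {\<bar>F u - F w\<bar> / L2_norm \<Omega> (\<lambda>x. u x - w x) | u w. u \<in> H \<and> w \<in> H \<and> u \<noteq> w}"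

definition subdifferential ::
    "(real^'k) set \<Rightarrow> ((real^'k \<Rightarrow> real^'l) set) \<Rightarrow> ((real^'k \<Rightarrow> real^'l) \<Rightarrow> real)
     \<Rightarrow> (real^'k \<Rightarrow> real^'l) \<Rightarrow> (real^'k \<Rightarrow> real^'l) set" where
  "subdifferential \<Omega> H F u =
     {\<zeta> \<in> H. \<forall>w\<in>H. L2_inner \<Omega> \<zeta> (\<lambda>x. w x - u x) + F u \<le> F w}"


section \<open>The modified minimizing movement scheme\<close>

definition num_steps :: "real \<Rightarrow> real \<Rightarrow> nat" where
  "num_steps T \<tau> = (LEAST n. T / \<tau> < real n)"

definition step_minimizer ::
    "(real^'k) set \<Rightarrow> 'i set \<Rightarrow> ('i \<Rightarrow> (real^'k) set) \<Rightarrow> (real^'l) set \<Rightarrow> real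
     \<Rightarrow> (real^'k \<Rightarrow> real^'l) \<Rightarrow> (real^'k \<Rightarrow> real^'l) \<Rightarrow> bool" where
  "step_minimizer \<Omega> \<Delta> C M \<tau> u X \<longleftrightarrow>
     is_arg_min (\<lambda>X. \<tau> * TV \<Delta> C (\<lambda>x. u x + X x) + 1 / 2 * (L2_norm \<Omega> X)\<^sup>2)
       (\<lambda>X. X \<in> TM_space \<Omega> \<Delta> C M u) X"

definition MM_step ::
    "(real^'k) set \<Rightarrow> 'i set \<Rightarrow> ('i \<Rightarrow> (real^'k) set) \<Rightarrow> (real^'l) set \<Rightarrow> real
     \<Rightarrow> (real^'k \<Rightarrow> real^'l) \<Rightarrow> (real^'k \<Rightarrow> real^'l)" where
  "MM_step \<Omega> \<Delta> C M \<tau> u = (THE X. step_minimizer \<Omega> \<Delta> C M \<tau> u X)"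

primrec MM_u ::
    "(real^'k) set \<Rightarrow> 'i set \<Rightarrow> ('i \<Rightarrow> (real^'k) set) \<Rightarrow> (real^'l) set \<Rightarrow> real
     \<Rightarrow> (real^'k \<Rightarrow> real^'l) \<Rightarrow> nat \<Rightarrow> (real^'k \<Rightarrow> real^'l)" where
  "MM_u \<Omega> \<Delta> C M \<tau> u\<^sub>0 0 = u\<^sub>0"
| "MM_u \<Omega> \<Delta> C M \<tau> u\<^sub>0 (Suc n) =
     Exp_map \<Delta> C M (MM_u \<Omega> \<Delta> C M \<tau> u\<^sub>0 n) (MM_step \<Omega> \<Delta> C M \<tau> (MM_u \<Omega> \<Delta> C M \<tau> u\<^sub>0 n))"

definition MM_X ::
    "(real^'k) set \<Rightarrow> 'i set \<Rightarrow> ('i \<Rightarrow> (real^'k) set) \<Rightarrow> (real^'l) set \<Rightarrow> real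
     \<Rightarrow> (real^'k \<Rightarrow> real^'l) \<Rightarrow> nat \<Rightarrow> (real^'k \<Rightarrow> real^'l)" where
  "MM_X \<Omega> \<Delta> C M \<tau> u\<^sub>0 n = MM_step \<Omega> \<Delta> C M \<tau> (MM_u \<Omega> \<Delta> C M \<tau> u\<^sub>0 n)"

end

theory Submission
  imports Defs
begin

text \<open>
  The function space \<open>H\<^sub>\<Delta>\<close> is the space of vector-valued functions on the vertices of a weighted
  graph: the vertices are the nonempty cells, weighted by volume, and a pair of cells is weighted by the
  area of its interface. In these coordinates the total variation is
  \<open>tv v = 1/2 \<Sum>\<^sub>\<alpha> \<Sum>\<^sub>\<beta> c \<alpha> \<beta> \<parallel>v \<alpha> - v \<beta>\<parallel>\<close>. It is the support function of the divergences of edge fields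
  bounded by one, and the maximum in \<open>tv v = max \<langle>divergence z, v\<rangle>\<close> is attained at the field
  \<open>z (\<alpha>, \<beta>) = sgn (v \<alpha> - v \<beta>)\<close>.

  A minimisation over the tangent space is therefore solved through its dual. Let \<open>P\<close> be the orthogonal
  projection onto the tangent space at \<open>u\<close>. The admissible edge fields form a compact set, on which the
  continuous function \<open>\<tau>/2 \<parallel>P (divergence z)\<parallel>\<^sup>2 - \<langle>divergence z, u\<rangle>\<close> has a minimiser \<open>z\<close>. Put
  \<open>\<zeta> = divergence z\<close> and \<open>X = - \<tau> P \<zeta>\<close>. The first-order condition says that \<open>\<zeta>\<close> maximises
  \<open>\<langle>\<cdot>, u + X\<rangle>\<close> among the divergences, so \<open>\<langle>\<zeta>, u + X\<rangle> = tv (u + X)\<close>, while \<open>\<langle>\<zeta>, w\<rangle> \<le> tv w\<close> for all \<open>w\<close>.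
  These two facts make \<open>\<zeta>\<close> a subgradient at \<open>u + X\<close> (\<open>exists_subgradient_along\<close>). Since \<open>X = - \<tau> P \<zeta>\<close>, the
  subgradient inequality for a tangential \<open>Z\<close> becomes

    \<open>\<tau> tv (u + X) + 1/2 \<parallel>X\<parallel>\<^sup>2 + 1/2 \<parallel>Z - X\<parallel>\<^sup>2 \<le> \<tau> tv (u + Z) + 1/2 \<parallel>Z\<parallel>\<^sup>2\<close>,

  which gives existence and uniqueness of the minimiser together with the inclusion
  (\<open>step_minimizer_characterization\<close>). The norm bound follows from
  \<open>\<parallel>\<zeta>\<parallel>\<^sup>2 \<le> tv \<zeta> \<le> Lip \<parallel>\<zeta>\<parallel>\<close> because projections are contractions.

  The manifold enters twice: tangent spaces are linear subspaces (\<open>subspace_tangent_space\<close>), and geodesics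
  stay on \<open>M\<close>, so that the exponential map leads back into \<open>M\<^sub>\<Delta>\<close> and the scheme can be continued.
\<close>

section \<open>Orthogonal projections\<close>

lemma orth_proj_decomposition:
  fixes S :: "'a::euclidean_space set"
  assumes "subspace S"
  shows "orth_proj S x \<in> S" and "x - orth_proj S x \<in> orthogonal_comp S"
proof -
  obtain y z where yz: "y \<in> span S" "\<And>w. w \<in> span S \<Longrightarrow> orthogonal z w" "x = y + z"
    using orthogonal_subspace_decomp_exists by blast
  have span: "span S = S"
    using assms by (simp add: span_eq_iff)
  have y: "y \<in> S \<and> x - y \<in> orthogonal_comp S"
    using yz by (auto simp: span orthogonal_comp_def orthogonal_commute)
  have "y' = y" if "y' \<in> S \<and> x - y' \<in> orthogonal_comp S" for y'
  proof -
    have d: "y' - y \<in> S"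
      using that y assms subspace_diff by blast
    have "(x - y) \<bullet> (y' - y) = 0" "(x - y') \<bullet> (y' - y) = 0"
      using d that y by (auto simp: orthogonal_comp_def orthogonal_def inner_commute)
    then have "(y' - y) \<bullet> (y' - y) = 0"
      by (simp add: inner_diff_left)
    then show ?thesis by simp
  qed
  with y have "orth_proj S x \<in> S \<and> x - orth_proj S x \<in> orthogonal_comp S"
    unfolding orth_proj_def by (rule theI)
  then show "orth_proj S x \<in> S" and "x - orth_proj S x \<in> orthogonal_comp S" by auto
qed

lemma orth_proj_inner:
  fixes S :: "'a::euclidean_space set"
  assumes "subspace S" and "v \<in> S"
  shows "orth_proj S x \<bullet> v = x \<bullet> v"
proof -
  have "(x - orth_proj S x) \<bullet> v = 0"
    using orth_proj_decomposition(2)[OF assms(1), of x] assms(2)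
    by (auto simp: orthogonal_comp_def orthogonal_def inner_commute)
  then show ?thesis by (simp add: inner_diff_left)
qed

lemma orth_proj_unique:
  fixes S :: "'a::euclidean_space set"
  assumes "subspace S" and "y \<in> S" and "\<And>v. v \<in> S \<Longrightarrow> y \<bullet> v = x \<bullet> v"
  shows "orth_proj S x = y"
proof -
  have "orth_proj S x - y \<in> S"
    using assms orth_proj_decomposition(1) subspace_diff by blast
  then have "(orth_proj S x - y) \<bullet> (orth_proj S x - y) = 0"
    using assms orth_proj_inner by (simp add: inner_diff_left)
  then show ?thesis by simp
qed

lemma linear_orth_proj:
  fixes S :: "'a::euclidean_space set"
  assumes "subspace S"
  shows "linear (orth_proj S)"
proof (rule linearI)
  show "orth_proj S (x + y) = orth_proj S x + orth_proj S y" for x y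
    using assms by (intro orth_proj_unique)
      (auto simp: orth_proj_decomposition orth_proj_inner inner_add_left intro: subspace_add)
  show "orth_proj S (r *\<^sub>R x) = r *\<^sub>R orth_proj S x" for r x
    using assms by (intro orth_proj_unique)
      (auto simp: orth_proj_decomposition orth_proj_inner intro: subspace_scale)
qed

lemma norm_orth_proj_le:
  fixes S :: "'a::euclidean_space set"
  assumes "subspace S"
  shows "norm (orth_proj S x) \<le> norm x"
proof -
  have "(norm (orth_proj S x))\<^sup>2 = x \<bullet> orth_proj S x"
    using orth_proj_inner[OF assms orth_proj_decomposition(1)[OF assms]]
    by (simp add: power2_norm_eq_inner)
  also have "\<dots> \<le> norm x * norm (orth_proj S x)"
    by (rule norm_cauchy_schwarz)
  finally have "norm (orth_proj S x) * norm (orth_proj S x) \<le> norm x * norm (orth_proj S x)"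
    by (simp add: power2_eq_square)
  then show ?thesis
    by (cases "orth_proj S x = 0") (auto dest: mult_right_le_imp_le)
qed

section \<open>Tangent spaces\<close>

text \<open>
  A chart \<open>\<phi>\<close> that flattens \<open>M\<close> to the linear space \<open>L\<close> identifies the tangent space at \<open>p\<close> with the
  preimage of \<open>L\<close> under the derivative \<open>D\<close> of \<open>\<phi>\<close> at \<open>p\<close>: curves in \<open>M\<close> are mapped to curves in \<open>L\<close>, and
  straight lines in \<open>L\<close> are mapped back by \<open>\<psi>\<close> to curves in \<open>M\<close>.
\<close>

lemma subspace_tangent_space:
  fixes M :: "'a::euclidean_space set"
  assumes "C2_submanifold M" and "p \<in> M"
  shows "subspace (tangent_space M p)"
proof -
  obtain U V :: "'a set" and \<phi> \<psi> L where U: "open U" "p \<in> U" and "open V"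
    and hom: "homeomorphism U V \<phi> \<psi>" and "C2_on U \<phi>" "C2_on V \<psi>"
    and L: "subspace L" and chart: "\<phi> ` (U \<inter> M) = V \<inter> L"
    using assms unfolding C2_submanifold_def by metis
  have \<phi>p: "\<phi> p \<in> V" "\<phi> p \<in> L" "\<psi> (\<phi> p) = p"
    using hom chart U assms(2) unfolding homeomorphism_def by auto
  obtain D where D: "(\<phi> has_derivative D) (at p)"
    using \<open>C2_on U \<phi>\<close> U unfolding C2_on_def C1_on_def by blast
  obtain E where E: "(\<psi> has_derivative E) (at (\<phi> p))"
    using \<open>C2_on V \<psi>\<close> \<phi>p unfolding C2_on_def C1_on_def by blast
  have "((\<lambda>x. \<psi> (\<phi> x)) has_derivative (\<lambda>h. E (D h))) (at p)"
    using diff_chain_at[OF D E] by (simp add: o_def)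
  then have "((\<lambda>x. x) has_derivative (\<lambda>h. E (D h))) (at p)"
    by (rule has_derivative_transform_within_open[OF _ U])
      (use hom in \<open>auto simp: homeomorphism_def\<close>)
  then have ED: "E (D v) = v" for v
    using has_derivative_unique[OF has_derivative_ident] by metis
  have "tangent_space M p = {v. D v \<in> L}"
  proof (intro equalityI subsetI CollectI)
    fix v assume "v \<in> tangent_space M p"
    then obtain k :: "real \<Rightarrow> 'a" and \<epsilon> where k: "\<epsilon> > 0" "\<And>t. \<bar>t\<bar> < \<epsilon> \<Longrightarrow> k t \<in> M" "k 0 = p"
      and kd: "(k has_vector_derivative v) (at 0)"
      unfolding tangent_space_def by blast
    have deriv: "((\<lambda>t. \<phi> (k t)) has_derivative (\<lambda>t. t *\<^sub>R D v)) (at 0)"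
      using diff_chain_at[of k "\<lambda>t. t *\<^sub>R v" 0 \<phi> D] kd D k(3)
        linear_scale[OF has_derivative_linear[OF D]]
      by (simp add: o_def has_vector_derivative_def)
    have "isCont k 0"
      using kd has_vector_derivative_continuous by blast
    then have "\<forall>\<^sub>F t in nhds 0. k t \<in> U"
      using U k(3) by (metis isCont_def tendsto_at_iff_tendsto_nhds topological_tendstoD)
    moreover have "\<forall>\<^sub>F t in nhds 0. k t \<in> M"
      using k(1,2) by (auto simp: eventually_nhds_metric dist_real_def)
    ultimately have "\<forall>\<^sub>F t in nhds 0. k t \<in> U \<inter> M"
      by eventually_elim auto
    then obtain S where S: "open S" "0 \<in> S" "\<And>t. t \<in> S \<Longrightarrow> k t \<in> U \<inter> M"
      unfolding eventually_nhds by blast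
    \<comment> \<open>The component \<open>w\<close> of \<open>D v\<close> normal to \<open>L\<close> vanishes because \<open>w \<bullet> \<phi> (k t)\<close> is constantly zero near \<open>t = 0\<close>.\<close>
    define w where "w = D v - orth_proj L (D v)"
    have w: "w \<bullet> l = 0" if "l \<in> L" for l
      using orth_proj_inner[OF L that] by (simp add: w_def inner_diff_left)
    have "((\<lambda>t. w \<bullet> \<phi> (k t)) has_derivative (\<lambda>t. w \<bullet> (t *\<^sub>R D v))) (at 0)"
      using deriv by (intro has_derivative_inner_right)
    then have "((\<lambda>t. 0) has_derivative (\<lambda>t. w \<bullet> (t *\<^sub>R D v))) (at (0::real))"
      by (rule has_derivative_transform_within_open[OF _ S(1,2)]) (use S(3) chart w in blast)
    then have "w \<bullet> (1 *\<^sub>R D v) = 0"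
      using has_derivative_unique[OF has_derivative_const] by metis
    then have "w \<bullet> w = 0"
      using w[OF orth_proj_decomposition(1)[OF L]] by (simp add: w_def inner_diff_right)
    then show "D v \<in> L"
      using orth_proj_decomposition(1)[OF L, of "D v"] by (simp add: w_def)
  next
    fix v assume "v \<in> {v. D v \<in> L}"
    then have Dv: "D v \<in> L" by simp
    define k where "k = (\<lambda>t. \<psi> (\<phi> p + t *\<^sub>R D v))"
    have "((\<lambda>t. \<phi> p + t *\<^sub>R D v) has_derivative (\<lambda>t. t *\<^sub>R D v)) (at 0)"
      by (auto intro!: derivative_eq_intros)
    then have "(k has_derivative (\<lambda>t. E (t *\<^sub>R D v))) (at 0)"
      using diff_chain_at[of "\<lambda>t. \<phi> p + t *\<^sub>R D v" _ 0 \<psi> E] E by (simp add: o_def k_def)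
    then have "(k has_vector_derivative v) (at 0)"
      using linear_scale[OF has_derivative_linear[OF E]] ED by (simp add: has_vector_derivative_def)
    moreover have "k 0 = p"
      by (simp add: k_def \<phi>p)
    moreover have "\<exists>\<epsilon>>0. \<forall>t. \<bar>t\<bar> < \<epsilon> \<longrightarrow> k t \<in> M"
    proof -
      have "((\<lambda>t. \<phi> p + t *\<^sub>R D v) \<longlongrightarrow> \<phi> p + 0 *\<^sub>R D v) (nhds (0::real))"
        by (intro tendsto_intros filterlim_ident)
      then have "\<forall>\<^sub>F t in nhds 0. \<phi> p + t *\<^sub>R D v \<in> V"
        using \<open>open V\<close> \<phi>p by (auto dest: topological_tendstoD)
      then obtain \<epsilon> where "\<epsilon> > 0" "\<And>t. \<bar>t\<bar> < \<epsilon> \<Longrightarrow> \<phi> p + t *\<^sub>R D v \<in> V"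
        by (auto simp: eventually_nhds_metric dist_real_def)
      moreover have "k t \<in> M" if "\<phi> p + t *\<^sub>R D v \<in> V" for t
      proof -
        have "\<phi> p + t *\<^sub>R D v \<in> V \<inter> L"
          using that \<phi>p Dv L by (auto intro: subspace_add subspace_scale)
        then obtain q where "q \<in> U \<inter> M" "\<phi> q = \<phi> p + t *\<^sub>R D v"
          using chart by (metis imageE)
        then show ?thesis
          using hom unfolding homeomorphism_def k_def by (metis IntD1 IntD2)
      qed
      ultimately show ?thesis by blast
    qed
    ultimately show "v \<in> tangent_space M p"
      unfolding tangent_space_def by blast
  qed
  moreover have "subspace {v. D v \<in> L}"
    using has_derivative_linear[OF D] L
    by (simp add: linear_subspace_vimage[unfolded vimage_def])
  ultimately show ?thesis by simp
qed

section \<open>Total variation on a weighted graph\<close>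

text \<open>
  First-order condition for a quadratic function on \<open>[0, 1]\<close> that has its minimum at the left end.
\<close>

lemma linear_part_nonneg:
  fixes a b :: real
  assumes "\<And>t. 0 < t \<Longrightarrow> t \<le> 1 \<Longrightarrow> 0 \<le> t * a + t\<^sup>2 * b"
  shows "0 \<le> a"
proof (rule ccontr)
  assume "\<not> 0 \<le> a"
  \<comment> \<open>For this \<open>s\<close> the linear term outweighs \<open>s * b\<close>, so the quadratic is negative on \<open>(0, s]\<close>.\<close>
  define s where "s = - a / (2 * (\<bar>b\<bar> + 1))"
  define t where "t = min 1 s"
  have s: "0 < s" "s * (2 * (\<bar>b\<bar> + 1)) = - a"
    using \<open>\<not> 0 \<le> a\<close> by (simp_all add: s_def divide_neg_pos)
  have t: "0 < t" "t \<le> 1" "t * (2 * (\<bar>b\<bar> + 1)) \<le> - a"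
    using s(1) unfolding t_def s(2)[symmetric] by (simp, simp, intro mult_right_mono) auto
  have "t * b \<le> t * (\<bar>b\<bar> + 1)" "0 < t * (\<bar>b\<bar> + 1)"
    using t(1) by (auto intro!: mult_left_mono)
  then have "a + t * b < 0"
    using t(3) by (simp add: algebra_simps)
  then have "t * (a + t * b) < 0"
    using t(1) by (simp add: mult_less_0_iff)
  then show False
    using assms[OF t(1,2)] by (simp add: algebra_simps power2_eq_square)
qed

locale weighted_graph =
  fixes A :: "'i set" and m :: "'i \<Rightarrow> real" and c :: "'i \<Rightarrow> 'i \<Rightarrow> real"
  assumes finite_vertices: "finite A"
    and vertex_weight_pos: "\<alpha> \<in> A \<Longrightarrow> m \<alpha> > 0"
    and edge_weight_nonneg: "c \<alpha> \<beta> \<ge> 0"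
    and edge_weight_sym: "c \<alpha> \<beta> = c \<beta> \<alpha>"
begin

definition ip :: "('i \<Rightarrow> 'b::euclidean_space) \<Rightarrow> ('i \<Rightarrow> 'b) \<Rightarrow> real" where
  "ip v w = (\<Sum>\<alpha>\<in>A. m \<alpha> * (v \<alpha> \<bullet> w \<alpha>))"

definition tv :: "('i \<Rightarrow> 'b::euclidean_space) \<Rightarrow> real" where
  "tv v = (\<Sum>\<alpha>\<in>A. \<Sum>\<beta>\<in>A. c \<alpha> \<beta> * norm (v \<alpha> - v \<beta>)) / 2"

text \<open>
  The adjoint of the gradient, which sends \<open>v\<close> to the edge field \<open>(\<alpha>, \<beta>) \<mapsto> v \<alpha> - v \<beta>\<close>; vertices carry the
  weights \<open>m\<close>, and an edge carries the weight \<open>c\<close>, half of it on each of its two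
  orientations. The difference \<open>z (\<alpha>, \<beta>) - z (\<beta>, \<alpha>)\<close> picks the antisymmetric part of a field, so that \<open>z\<close>
  itself can be arbitrary and the admissible fields form a product of balls.
\<close>

definition divergence :: "('i \<times> 'i \<Rightarrow> 'b::euclidean_space) \<Rightarrow> 'i \<Rightarrow> 'b" where
  "divergence z \<alpha> = (1 / (2 * m \<alpha>)) *\<^sub>R (\<Sum>\<beta>\<in>A. c \<alpha> \<beta> *\<^sub>R (z (\<alpha>, \<beta>) - z (\<beta>, \<alpha>)))"

lemma ip_commute: "ip v w = ip w v"
  by (simp add: ip_def inner_commute)

lemma ip_add_left: "ip (\<lambda>\<alpha>. v \<alpha> + v' \<alpha>) w = ip v w + ip v' w"
  by (simp add: ip_def inner_add_left distrib_left sum.distrib)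

lemma ip_diff_left: "ip (\<lambda>\<alpha>. v \<alpha> - v' \<alpha>) w = ip v w - ip v' w"
  by (simp add: ip_def inner_diff_left right_diff_distrib sum_subtractf)

lemma ip_scale_left: "ip (\<lambda>\<alpha>. r *\<^sub>R v \<alpha>) w = r * ip v w"
  by (simp add: ip_def sum_distrib_left mult_ac)

lemma ip_add_right: "ip w (\<lambda>\<alpha>. v \<alpha> + v' \<alpha>) = ip w v + ip w v'"
  by (simp add: ip_commute[of w] ip_add_left)

lemma ip_diff_right: "ip w (\<lambda>\<alpha>. v \<alpha> - v' \<alpha>) = ip w v - ip w v'"
  by (simp add: ip_commute[of w] ip_diff_left)

lemma ip_scale_right: "ip w (\<lambda>\<alpha>. r *\<^sub>R v \<alpha>) = r * ip w v"
  by (simp add: ip_commute[of w] ip_scale_left)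

lemmas ip_simps = ip_add_left ip_diff_left ip_scale_left ip_add_right ip_diff_right ip_scale_right

lemma ip_self_nonneg: "ip v v \<ge> 0"
  unfolding ip_def using vertex_weight_pos by (intro sum_nonneg) (simp add: less_imp_le)

lemma ip_self_eq_0:
  assumes "ip v v = 0" and "\<alpha> \<in> A"
  shows "v \<alpha> = 0"
proof -
  have "m \<alpha> * (v \<alpha> \<bullet> v \<alpha>) = 0"
    by (rule sum_nonneg_0[OF finite_vertices, where f = "\<lambda>\<alpha>. m \<alpha> * (v \<alpha> \<bullet> v \<alpha>)"])
      (use assms vertex_weight_pos in \<open>simp_all add: ip_def less_imp_le\<close>)
  then show ?thesis
    using vertex_weight_pos[OF assms(2)] by simp
qed

text \<open>
  Summation by parts: the two halves of the antisymmetric part are exchanged by swapping the roles of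
  the two ends of an edge.
\<close>

lemma ip_divergence: "ip (divergence z) v = (\<Sum>\<alpha>\<in>A. \<Sum>\<beta>\<in>A. c \<alpha> \<beta> * (z (\<alpha>, \<beta>) \<bullet> (v \<alpha> - v \<beta>))) / 2"
proof -
  have "m \<alpha> * (divergence z \<alpha> \<bullet> v \<alpha>) = (\<Sum>\<beta>\<in>A. c \<alpha> \<beta> * ((z (\<alpha>, \<beta>) - z (\<beta>, \<alpha>)) \<bullet> v \<alpha>)) / 2"
    if "\<alpha> \<in> A" for \<alpha>
    using vertex_weight_pos[OF that] by (simp add: divergence_def inner_sum_left)
  then have "2 * ip (divergence z) v = (\<Sum>\<alpha>\<in>A. \<Sum>\<beta>\<in>A. c \<alpha> \<beta> * ((z (\<alpha>, \<beta>) - z (\<beta>, \<alpha>)) \<bullet> v \<alpha>))"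
    unfolding ip_def sum_distrib_left by (intro sum.cong refl) (simp add: mult.commute)
  also have "\<dots> = (\<Sum>\<alpha>\<in>A. \<Sum>\<beta>\<in>A. c \<alpha> \<beta> * (z (\<alpha>, \<beta>) \<bullet> v \<alpha>))
      - (\<Sum>\<alpha>\<in>A. \<Sum>\<beta>\<in>A. c \<alpha> \<beta> * (z (\<beta>, \<alpha>) \<bullet> v \<alpha>))"
    by (simp add: inner_diff_left right_diff_distrib sum_subtractf)
  also have "(\<Sum>\<alpha>\<in>A. \<Sum>\<beta>\<in>A. c \<alpha> \<beta> * (z (\<beta>, \<alpha>) \<bullet> v \<alpha>))
      = (\<Sum>\<alpha>\<in>A. \<Sum>\<beta>\<in>A. c \<alpha> \<beta> * (z (\<alpha>, \<beta>) \<bullet> v \<beta>))"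
    by (subst sum.swap) (simp add: edge_weight_sym)
  finally have "2 * ip (divergence z) v = (\<Sum>\<alpha>\<in>A. \<Sum>\<beta>\<in>A. c \<alpha> \<beta> * (z (\<alpha>, \<beta>) \<bullet> (v \<alpha> - v \<beta>)))"
    by (simp add: inner_diff_right right_diff_distrib sum_subtractf)
  then show ?thesis by simp
qed

lemma ip_divergence_le_tv:
  assumes "\<And>e. norm (z e) \<le> 1"
  shows "ip (divergence z) v \<le> tv v"
proof -
  have "z e \<bullet> w \<le> norm w" for e w
    using norm_cauchy_schwarz[of "z e" w] mult_right_mono[OF assms, of "norm w" e] by simp
  then show ?thesis
    unfolding ip_divergence tv_def
    by (intro divide_right_mono sum_mono mult_left_mono edge_weight_nonneg) auto
qed

lemma ip_divergence_sgn:
  fixes v :: "'i \<Rightarrow> 'b::euclidean_space"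
  shows "ip (divergence (\<lambda>(\<alpha>, \<beta>). sgn (v \<alpha> - v \<beta>))) v = tv v"
proof -
  have "sgn w \<bullet> w = norm w" for w :: 'b
    by (cases "w = 0") (auto simp: sgn_div_norm dot_square_norm power2_eq_square)
  then show ?thesis by (simp add: ip_divergence tv_def)
qed

lemma divergence_affine:
  "divergence (\<lambda>e. z e + t *\<^sub>R (z' e - z e)) \<alpha> = divergence z \<alpha> + t *\<^sub>R (divergence z' \<alpha> - divergence z \<alpha>)"
proof -
  have "c \<alpha> \<beta> *\<^sub>R ((z (\<alpha>, \<beta>) + t *\<^sub>R (z' (\<alpha>, \<beta>) - z (\<alpha>, \<beta>)))
        - (z (\<beta>, \<alpha>) + t *\<^sub>R (z' (\<beta>, \<alpha>) - z (\<beta>, \<alpha>))))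
      = c \<alpha> \<beta> *\<^sub>R (z (\<alpha>, \<beta>) - z (\<beta>, \<alpha>))
        + t *\<^sub>R (c \<alpha> \<beta> *\<^sub>R (z' (\<alpha>, \<beta>) - z' (\<beta>, \<alpha>)) - c \<alpha> \<beta> *\<^sub>R (z (\<alpha>, \<beta>) - z (\<beta>, \<alpha>)))" for \<beta>
    by (simp add: algebra_simps)
  then show ?thesis
    by (simp only: divergence_def sum.distrib sum_subtractf scaleR_sum_right[symmetric]
        scaleR_add_right scaleR_diff_right scaleR_left_commute[of _ t])
qed

text \<open>
  A product of closed balls is compact by Tychonoff's theorem, which yields a minimiser of the dual
  problem.
\<close>

lemma exists_dual_optimum:
  fixes V :: "'i \<Rightarrow> 'b::euclidean_space set" and u :: "'i \<Rightarrow> 'b" and \<tau> :: real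
  assumes V: "\<And>\<alpha>. \<alpha> \<in> A \<Longrightarrow> subspace (V \<alpha>)"
  defines "P \<equiv> \<lambda>v \<alpha>. orth_proj (V \<alpha>) (v \<alpha>)"
  defines "G \<equiv> \<lambda>z. \<tau> / 2 * ip (P (divergence z)) (P (divergence z)) - ip (divergence z) u"
  shows "\<exists>z. (\<forall>e. norm (z e) \<le> 1) \<and> (\<forall>z'. (\<forall>e. norm (z' e) \<le> 1) \<longrightarrow> G z \<le> G z')"
proof -
  let ?K = "{z :: 'i \<times> 'i \<Rightarrow> 'b. \<forall>e. norm (z e) \<le> 1}"
  have "?K = (\<Pi>\<^sub>E e\<in>UNIV. cball 0 1)"
    by (auto simp: PiE_def Pi_def)
  moreover have "compactin (product_topology (\<lambda>e. euclidean) UNIV)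
      (\<Pi>\<^sub>E e\<in>(UNIV :: ('i \<times> 'i) set). cball (0::'b) 1)"
    by (simp add: compactin_PiE)
  ultimately have "compact ?K"
    by (simp add: euclidean_product_topology)
  moreover have "?K \<noteq> {}"
    by (auto intro: exI[of _ "\<lambda>_. 0"])
  moreover have "continuous_on ?K G"
  proof -
    have coordinate: "continuous_on ?K (\<lambda>z. z e)" for e
      using continuous_on_product_then_coordinatewise[OF continuous_on_id, of ?K e] by simp
    have divergence: "continuous_on ?K (\<lambda>z. divergence z \<alpha>)" for \<alpha>
      unfolding divergence_def 
      by (intro continuous_on_scaleR continuous_on_const continuous_on_sum continuous_on_diff coordinate)
    have "continuous_on ?K (\<lambda>z. P (divergence z) \<alpha>)" if "\<alpha> \<in> A" for \<alpha>
      unfolding P_def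
      using linear_orth_proj[OF V[OF that]]
      by (intro bounded_linear.continuous_on[OF _ divergence]) (simp add: linear_conv_bounded_linear)
    then show ?thesis
      unfolding G_def ip_def
      by (intro continuous_on_diff continuous_on_mult continuous_on_const continuous_on_sum
          continuous_on_inner divergence)
  qed
  ultimately have "\<exists>z\<in>?K. \<forall>z'\<in>?K. G z \<le> G z'"
    by (rule continuous_attains_inf)
  then show ?thesis by auto
qed

text \<open>
  For \<open>X = - \<tau> P \<zeta>\<close> the two conclusions state that \<open>\<zeta>\<close> is a subgradient of the one-homogeneous
  convex function \<open>tv\<close> at \<open>y = u + X\<close>. They hold for the divergence of a dual optimum \<open>z\<close>: perturbing \<open>z\<close> towards
  another admissible field shows that no divergence pairs better with \<open>y\<close> than \<open>\<zeta>\<close> does, and the field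
  \<open>sgn (y \<alpha> - y \<beta>)\<close> already reaches \<open>tv y\<close>.
\<close>

lemma exists_subgradient_along:
  fixes V :: "'i \<Rightarrow> 'b::euclidean_space set" and u :: "'i \<Rightarrow> 'b" and \<tau> :: real
  assumes V: "\<And>\<alpha>. \<alpha> \<in> A \<Longrightarrow> subspace (V \<alpha>)"
  obtains \<zeta> where "\<And>w. ip \<zeta> w \<le> tv w"
    and "ip \<zeta> (\<lambda>\<alpha>. u \<alpha> - \<tau> *\<^sub>R orth_proj (V \<alpha>) (\<zeta> \<alpha>))
      = tv (\<lambda>\<alpha>. u \<alpha> - \<tau> *\<^sub>R orth_proj (V \<alpha>) (\<zeta> \<alpha>))"
proof -
  define P where "P = (\<lambda>v \<alpha>. orth_proj (V \<alpha>) (v \<alpha> :: 'b))"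
  define G where "G = (\<lambda>z. \<tau> / 2 * ip (P (divergence z)) (P (divergence z)) - ip (divergence z) u)"
  obtain z where z: "\<And>e. norm (z e) \<le> 1" and
    opt: "\<And>z'. (\<And>e. norm (z' e) \<le> 1) \<Longrightarrow> G z \<le> G z'"
    using exists_dual_optimum[of V \<tau> u, OF V] unfolding G_def P_def by blast
  define \<zeta> where "\<zeta> = divergence z"
  define y where "y = (\<lambda>\<alpha>. u \<alpha> - \<tau> *\<^sub>R P \<zeta> \<alpha>)"
  have P_ip: "ip (P v) (P w) = ip (P v) w" for v w
    unfolding ip_def P_def using V
    by (intro sum.cong refl) (metis inner_commute orth_proj_inner orth_proj_decomposition(1))
  \<comment> \<open>The derivative of the dual functional at \<open>\<zeta>\<close> in direction \<open>d\<close> is \<open>\<tau> \<langle>P \<zeta>, d\<rangle> - \<langle>d, u\<rangle> = - \<langle>d, y\<rangle>\<close>.\<close>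
  have maximal: "ip (divergence z') y \<le> ip \<zeta> y" if z': "\<And>e. norm (z' e) \<le> 1" for z'
  proof -
    define d where "d = (\<lambda>\<alpha>. divergence z' \<alpha> - \<zeta> \<alpha>)"
    have "0 \<le> t * (- ip d y) + t\<^sup>2 * (\<tau> / 2 * ip (P d) (P d))" if t: "0 < t" "t \<le> 1" for t
    proof -
      let ?zt = "\<lambda>e. z e + t *\<^sub>R (z' e - z e)"
      have "norm (?zt e) \<le> 1" for e
      proof -
        have "?zt e = (1 - t) *\<^sub>R z e + t *\<^sub>R z' e"
          by (simp add: algebra_simps)
        moreover have "(1 - t) *\<^sub>R z e + t *\<^sub>R z' e \<in> cball 0 1"
          using z z' t by (intro convexD[OF convex_cball]) auto
        ultimately show ?thesis by simp
      qed
      then have "G z \<le> G ?zt" by (rule opt)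
      moreover have "divergence ?zt = (\<lambda>\<alpha>. \<zeta> \<alpha> + t *\<^sub>R d \<alpha>)"
        by (auto simp: divergence_affine \<zeta>_def d_def)
      moreover have "ip (P (\<lambda>\<alpha>. \<zeta> \<alpha> + t *\<^sub>R d \<alpha>)) (P (\<lambda>\<alpha>. \<zeta> \<alpha> + t *\<^sub>R d \<alpha>))
          = ip (\<lambda>\<alpha>. P \<zeta> \<alpha> + t *\<^sub>R P d \<alpha>) (\<lambda>\<alpha>. P \<zeta> \<alpha> + t *\<^sub>R P d \<alpha>)"
        unfolding ip_def P_def using V
        by (intro sum.cong refl) (simp add: linear_add linear_scale linear_orth_proj)
      moreover have "\<dots> = ip (P \<zeta>) (P \<zeta>) + 2 * t * ip (P \<zeta>) (P d) + t\<^sup>2 * ip (P d) (P d)"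
        by (simp add: ip_simps ip_commute[of "P d" "P \<zeta>"] algebra_simps power2_eq_square)
      ultimately have "0 \<le> \<tau> / 2 * (2 * t * ip (P \<zeta>) (P d) + t\<^sup>2 * ip (P d) (P d)) - t * ip d u"
        by (simp add: G_def \<zeta>_def[symmetric] ip_simps algebra_simps)
      then show ?thesis
        using P_ip[of \<zeta> d] by (simp add: y_def ip_simps ip_commute[of d] algebra_simps)
    qed
    then have "0 \<le> - ip d y" by (rule linear_part_nonneg)
    then show ?thesis by (simp add: d_def ip_simps)
  qed
  have "tv y \<le> ip \<zeta> y"
    using maximal[of "\<lambda>(\<alpha>, \<beta>). sgn (y \<alpha> - y \<beta>)"] ip_divergence_sgn[of y]
    by (auto simp: norm_sgn)
  moreover have bound: "ip \<zeta> w \<le> tv w" for w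
    unfolding \<zeta>_def using z by (rule ip_divergence_le_tv)
  ultimately have "ip \<zeta> y = tv y" by (simp add: order_antisym)
  with bound show thesis
    using that[of \<zeta>] unfolding y_def P_def by blast
qed

lemma tv_triangle: "tv v - tv w \<le> tv (\<lambda>\<alpha>. v \<alpha> - w \<alpha>)"
proof -
  have "norm (v \<alpha> - v \<beta>) \<le> norm (w \<alpha> - w \<beta>) + norm ((v \<alpha> - w \<alpha>) - (v \<beta> - w \<beta>))" for \<alpha> \<beta>
    using norm_triangle_ineq[of "w \<alpha> - w \<beta>" "(v \<alpha> - w \<alpha>) - (v \<beta> - w \<beta>)"] by (simp add: algebra_simps)
  then have "2 * tv v \<le> (\<Sum>\<alpha>\<in>A. \<Sum>\<beta>\<in>A. c \<alpha> \<beta> *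
      (norm (w \<alpha> - w \<beta>) + norm ((v \<alpha> - w \<alpha>) - (v \<beta> - w \<beta>))))"
    unfolding tv_def by (simp, intro sum_mono mult_left_mono edge_weight_nonneg)
  also have "\<dots> = 2 * tv w + 2 * tv (\<lambda>\<alpha>. v \<alpha> - w \<alpha>)"
    by (simp add: tv_def distrib_left sum.distrib)
  finally show ?thesis by simp
qed

lemma abs_tv_diff_le: "\<bar>tv v - tv w\<bar> \<le> tv (\<lambda>\<alpha>. v \<alpha> - w \<alpha>)"
proof -
  have "norm ((w \<alpha> - v \<alpha>) - (w \<beta> - v \<beta>)) = norm ((v \<alpha> - w \<alpha>) - (v \<beta> - w \<beta>))" for \<alpha> \<beta>
    using norm_minus_commute[of "v \<alpha> - w \<alpha>" "v \<beta> - w \<beta>"] by (simp add: algebra_simps)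
  then have "tv (\<lambda>\<alpha>. w \<alpha> - v \<alpha>) = tv (\<lambda>\<alpha>. v \<alpha> - w \<alpha>)"
    by (simp add: tv_def)
  then show ?thesis
    using tv_triangle[of v w] tv_triangle[of w v] by simp
qed

text \<open>
  The total variation is bounded in terms of the norm because a single vertex value is:
  \<open>m \<alpha> \<parallel>v \<alpha>\<parallel>\<^sup>2 \<le> \<langle>v, v\<rangle>\<close>. This makes the supremum that defines the Lipschitz constant finite.
\<close>

lemma tv_le_const_norm: "tv v \<le> (\<Sum>\<alpha>\<in>A. \<Sum>\<beta>\<in>A. c \<alpha> \<beta> / sqrt (m \<alpha>)) * sqrt (ip v v)"
proof -
  have vertex: "norm (v \<alpha>) \<le> sqrt (ip v v) / sqrt (m \<alpha>)" if "\<alpha> \<in> A" for \<alpha>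
  proof -
    have "m \<alpha> * (norm (v \<alpha>))\<^sup>2 \<le> ip v v"
      unfolding ip_def power2_norm_eq_inner using that finite_vertices
      using vertex_weight_pos by (intro member_le_sum) (simp_all add: less_imp_le)
    then have "sqrt (m \<alpha> * (norm (v \<alpha>))\<^sup>2) \<le> sqrt (ip v v)"
      by (rule real_sqrt_le_mono)
    then show ?thesis
      using vertex_weight_pos[OF that] by (simp add: real_sqrt_mult field_simps)
  qed
  have "2 * tv v \<le> (\<Sum>\<alpha>\<in>A. \<Sum>\<beta>\<in>A. c \<alpha> \<beta> * (norm (v \<alpha>) + norm (v \<beta>)))"
    unfolding tv_def by (simp, intro sum_mono mult_left_mono edge_weight_nonneg norm_triangle_ineq4)
  also have "\<dots> = (\<Sum>\<alpha>\<in>A. \<Sum>\<beta>\<in>A. c \<alpha> \<beta> * norm (v \<alpha>)) + (\<Sum>\<alpha>\<in>A. \<Sum>\<beta>\<in>A. c \<alpha> \<beta> * norm (v \<beta>))"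
    by (simp add: distrib_left sum.distrib)
  also have "(\<Sum>\<alpha>\<in>A. \<Sum>\<beta>\<in>A. c \<alpha> \<beta> * norm (v \<beta>)) = (\<Sum>\<alpha>\<in>A. \<Sum>\<beta>\<in>A. c \<alpha> \<beta> * norm (v \<alpha>))"
    by (subst sum.swap) (simp add: edge_weight_sym)
  finally have "tv v \<le> (\<Sum>\<alpha>\<in>A. \<Sum>\<beta>\<in>A. c \<alpha> \<beta> * norm (v \<alpha>))" by simp
  also have "\<dots> \<le> (\<Sum>\<alpha>\<in>A. \<Sum>\<beta>\<in>A. c \<alpha> \<beta> * (sqrt (ip v v) / sqrt (m \<alpha>)))"
    by (intro sum_mono mult_left_mono edge_weight_nonneg vertex)
  also have "\<dots> = (\<Sum>\<alpha>\<in>A. \<Sum>\<beta>\<in>A. c \<alpha> \<beta> / sqrt (m \<alpha>)) * sqrt (ip v v)"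
    by (simp add: sum_distrib_right)
  finally show ?thesis .
qed

end

section \<open>Step functions on a rectangular partition\<close>

text \<open>
  An empty cell has an empty interface with every other cell; vanishing of its measure excludes such
  cells from all edges.
\<close>

lemma hausdorff_measure_empty: "hausdorff_measure n ({} :: 'a::metric_space set) = 0"
proof -
  have "hausdorff_premeasure n \<delta> ({} :: 'a set) \<le> (\<Sum>i::nat. hausdorff_weight n ({} :: 'a set))" if "\<delta> > 0" for \<delta>
    unfolding hausdorff_premeasure_def
    by (rule INF_lower2[where i = "\<lambda>_. {}"]) (use that in auto)
  then show ?thesis
    by (simp add: hausdorff_measure_def hausdorff_weight_def SUP_eq_iff)
qed

lemma open_null_set_empty: "open S \<Longrightarrow> emeasure lebesgue S = 0 \<Longrightarrow> S = {}"
  using open_not_negligible[of S] negligible_iff_emeasure0[of S] by (auto simp: borel_open)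

locale rectangular_cells =
  fixes \<Omega> :: "(real^'k) set" and \<Delta> :: "'i set" and C :: "'i \<Rightarrow> (real^'k) set"
  assumes domain: "open \<Omega>" "bounded \<Omega>" "\<Omega> \<noteq> {}"
    and partition: "rectangular_partition \<Omega> \<Delta> C"
begin

text \<open>
  The value of a function on an empty cell is meaningless and an empty cell has volume zero, so only the
  nonempty cells serve as vertices of the graph.
\<close>

definition cells :: "'i set" where
  "cells = {\<alpha> \<in> \<Delta>. C \<alpha> \<noteq> {}}"

definition vol :: "'i \<Rightarrow> real" where
  "vol \<alpha> = measure lebesgue (C \<alpha>)"

definition area :: "'i \<Rightarrow> 'i \<Rightarrow> real" where
  "area \<alpha> \<beta> = enn2real (hausdorff_measure (CARD('k) - 1) (interface C {\<alpha>, \<beta>}))"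

definition step :: "('i \<Rightarrow> real^'l) \<Rightarrow> real^'k \<Rightarrow> real^'l" where
  "step v x = (\<Sum>\<alpha>\<in>cells. indicator (C \<alpha>) x *\<^sub>R v \<alpha>)"

lemma finite_cells: "finite cells"
  using partition by (simp add: cells_def rectangular_partition_def)

lemma open_cell:
  assumes "\<alpha> \<in> \<Delta>"
  shows "open (C \<alpha>)" and "C \<alpha> \<subseteq> \<Omega>"
proof -
  obtain a b where "C \<alpha> = box a b \<inter> \<Omega>"
    using assms partition unfolding rectangular_partition_def by blast
  then show "open (C \<alpha>)" and "C \<alpha> \<subseteq> \<Omega>"
    using domain by (auto intro: open_box)
qed

lemma cell_lmeasurable: "\<alpha> \<in> \<Delta> \<Longrightarrow> C \<alpha> \<in> lmeasurable"
  using open_cell domain by (meson bounded_subset lmeasurable_open)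

lemma cells_disjoint:
  assumes "\<alpha> \<in> \<Delta>" "\<beta> \<in> \<Delta>" "\<alpha> \<noteq> \<beta>"
  shows "C \<alpha> \<inter> C \<beta> = {}"
  using assms partition unfolding rectangular_partition_def
  by (intro open_null_set_empty) (auto intro: open_cell)

lemma vol_pos:
  assumes "\<alpha> \<in> cells"
  shows "vol \<alpha> > 0"
proof -
  have "\<not> negligible (C \<alpha>)"
    using assms open_not_negligible open_cell unfolding cells_def by blast
  then show ?thesis
    using assms cell_lmeasurable by (auto simp: vol_def cells_def negligible_iff_measure0 zero_less_measure_iff)
qed

text \<open>If all cells were empty, the nonempty open set \<open>\<Omega>\<close> would be a null set.\<close>

lemma cells_nonempty: "cells \<noteq> {}"
proof
  assume "cells = {}"
  then have "\<Omega> - (\<Union>\<alpha>\<in>\<Delta>. C \<alpha>) = \<Omega>"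
    by (auto simp: cells_def)
  then show False
    using partition domain open_null_set_empty unfolding rectangular_partition_def by metis
qed

sublocale weighted_graph cells vol area
  by standard (auto simp: finite_cells vol_pos area_def insert_commute)

lemma Union_cells: "(\<Union>\<alpha>\<in>\<Delta>. C \<alpha>) = (\<Union>\<alpha>\<in>cells. C \<alpha>)"
  by (auto simp: cells_def)

lemma step_eq:
  assumes "\<alpha> \<in> \<Delta>" and "x \<in> C \<alpha>"
  shows "step v x = v \<alpha>"
proof -
  have "step v x = (\<Sum>\<beta>\<in>cells. if \<beta> = \<alpha> then v \<alpha> else 0)"
    unfolding step_def using cells_disjoint assms
    by (intro sum.cong refl) (auto simp: cells_def indicator_def)
  then show ?thesis
    using assms finite_cells by (auto simp: cells_def)
qed

lemma step_eq_0: "x \<notin> (\<Union>\<alpha>\<in>\<Delta>. C \<alpha>) \<Longrightarrow> step v x = 0"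
  by (auto simp: step_def Union_cells intro!: sum.neutral)

text \<open>
  This carries pointwise operations on step functions over to operations on their cell values.
\<close>

lemma step_eqI:
  assumes "\<And>\<alpha> x. \<alpha> \<in> cells \<Longrightarrow> x \<in> C \<alpha> \<Longrightarrow> U x = v \<alpha>"
    and "\<And>x. x \<notin> (\<Union>\<alpha>\<in>\<Delta>. C \<alpha>) \<Longrightarrow> U x = 0"
  shows "U = step v"
proof
  fix x
  show "U x = step v x"
  proof (cases "x \<in> (\<Union>\<alpha>\<in>\<Delta>. C \<alpha>)")
    case True
    then obtain \<alpha> where "\<alpha> \<in> cells" "x \<in> C \<alpha>"
      unfolding Union_cells by blast
    then show ?thesis
      using assms(1) step_eq[of \<alpha> x v] by (simp add: cells_def)
  qed (simp add: assms(2) step_eq_0)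
qed

lemma step_add: "(\<lambda>x. step v x + step w x) = step (\<lambda>\<alpha>. v \<alpha> + w \<alpha>)"
  by (rule step_eqI) (auto simp: step_eq step_eq_0 cells_def)

lemma step_diff: "(\<lambda>x. step v x - step w x) = step (\<lambda>\<alpha>. v \<alpha> - w \<alpha>)"
  by (rule step_eqI) (auto simp: step_eq step_eq_0 cells_def)

lemma step_eq_iff: "step v = step w \<longleftrightarrow> (\<forall>\<alpha>\<in>cells. v \<alpha> = w \<alpha>)"
proof
  assume eq: "step v = step w"
  show "\<forall>\<alpha>\<in>cells. v \<alpha> = w \<alpha>"
  proof
    fix \<alpha> assume "\<alpha> \<in> cells"
    then obtain x where "\<alpha> \<in> \<Delta>" "x \<in> C \<alpha>" by (auto simp: cells_def)
    then show "v \<alpha> = w \<alpha>"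
      using step_eq eq by metis
  qed
qed (auto simp: step_def fun_eq_iff)

lemma step_inner: "step v x \<bullet> step w x = (\<Sum>\<alpha>\<in>cells. indicator (C \<alpha>) x * (v \<alpha> \<bullet> w \<alpha>))"
proof (cases "x \<in> (\<Union>\<alpha>\<in>\<Delta>. C \<alpha>)")
  case True
  then obtain \<alpha> where \<alpha>: "\<alpha> \<in> \<Delta>" "x \<in> C \<alpha>" by blast
  have "step v x \<bullet> step w x = step v x \<bullet> w \<alpha>"
    using \<alpha> by (simp add: step_eq)
  also have "\<dots> = (\<Sum>\<beta>\<in>cells. indicator (C \<beta>) x * (v \<beta> \<bullet> w \<alpha>))"
    by (simp add: step_def inner_sum_left)
  also have "\<dots> = (\<Sum>\<beta>\<in>cells. indicator (C \<beta>) x * (v \<beta> \<bullet> w \<beta>))"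
    using cells_disjoint \<alpha> by (intro sum.cong refl) (auto simp: cells_def indicator_def)
  finally show ?thesis .
next
  case False
  then show ?thesis
    using step_eq_0[of x v] by (auto simp: Union_cells intro!: sum.neutral[symmetric])
qed

lemma has_integral_step_inner:
  "has_bochner_integral (lebesgue_on \<Omega>) (\<lambda>x. step v x \<bullet> step w x) (ip v w)"
proof -
  have "has_bochner_integral (lebesgue_on \<Omega>) (\<lambda>x. indicator (C \<alpha>) x * (v \<alpha> \<bullet> w \<alpha>)) (vol \<alpha> * (v \<alpha> \<bullet> w \<alpha>))"
    if "\<alpha> \<in> cells" for \<alpha>
  proof (rule has_bochner_integral_mult_left)
    have \<alpha>: "C \<alpha> \<subseteq> \<Omega>" "C \<alpha> \<in> lmeasurable" and \<Omega>: "\<Omega> \<in> sets lebesgue"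
      using that open_cell cell_lmeasurable domain by (auto simp: cells_def borel_open)
    have "has_bochner_integral (lebesgue_on \<Omega>) (indicator (C \<alpha>)) (measure (lebesgue_on \<Omega>) (C \<alpha>))"
      using \<alpha> \<Omega> by (intro has_bochner_integral_real_indicator)
        (auto simp: sets_restrict_space_iff emeasure_restrict_space fmeasurable_def)
    then show "has_bochner_integral (lebesgue_on \<Omega>) (indicator (C \<alpha>)) (vol \<alpha>)"
      using \<alpha> \<Omega> by (simp add: vol_def measure_restrict_space)
  qed
  then show ?thesis
    unfolding step_inner ip_def by (rule has_bochner_integral_sum)
qed

lemma L2_inner_step: "L2_inner \<Omega> (step v) (step w) = ip v w"
  unfolding L2_inner_def by (rule has_bochner_integral_integral_eq[OF has_integral_step_inner])

lemma L2_norm_step: "L2_norm \<Omega> (step v) = sqrt (ip v v)"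
  by (simp add: L2_norm_def L2_inner_step)

lemma step_in_H_space: "step v \<in> H_space \<Omega> \<Delta> C"
proof -
  have "step v \<in> borel_measurable lebesgue"
    unfolding step_def using cell_lmeasurable
    by (intro borel_measurable_sum borel_measurable_scaleR borel_measurable_const borel_measurable_indicator)
      (auto simp: cells_def fmeasurableD)
  then have "step v \<in> borel_measurable (lebesgue_on \<Omega>)"
    by (rule measurable_restrict_space1)
  moreover have "integrable (lebesgue_on \<Omega>) (\<lambda>x. (norm (step v x))\<^sup>2)"
    using has_integral_step_inner[of v v] by (simp add: power2_norm_eq_inner has_bochner_integral_iff)
  moreover have "step v constant_on C \<alpha>" if "\<alpha> \<in> \<Delta>" for \<alpha>
    using step_eq[OF that] by (auto simp: constant_on_def)
  ultimately show ?thesis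
    using step_eq_0 by (auto simp: H_space_def L2_space_def)
qed

lemma H_space_eq_range_step: "H_space \<Omega> \<Delta> C = range step"
proof
  show "H_space \<Omega> \<Delta> C \<subseteq> range step"
  proof
    fix U :: "real^'k \<Rightarrow> real^'l" assume U: "U \<in> H_space \<Omega> \<Delta> C"
    then have "\<forall>\<alpha>\<in>\<Delta>. \<exists>y. \<forall>x\<in>C \<alpha>. U x = y"
      by (auto simp: H_space_def constant_on_def)
    then obtain v where "\<And>\<alpha> x. \<alpha> \<in> \<Delta> \<Longrightarrow> x \<in> C \<alpha> \<Longrightarrow> U x = v \<alpha>"
      by metis
    then have "U = step v"
      using U by (intro step_eqI) (auto simp: H_space_def cells_def)
    then show "U \<in> range step" by blast
  qed
qed (use step_in_H_space in blast)

lemma cell_value_step: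
  assumes "\<alpha> \<in> cells"
  shows "cell_value C (step v) \<alpha> = v \<alpha>"
proof -
  have "step v ` C \<alpha> = {v \<alpha>}"
  proof (rule equalityI)
    show "{v \<alpha>} \<subseteq> step v ` C \<alpha>"
      using assms step_eq[of \<alpha> _ v] by (auto simp: cells_def image_iff)
  qed (use assms step_eq[of \<alpha> _ v] in \<open>auto simp: cells_def\<close>)
  then show ?thesis by (simp add: cell_value_def)
qed

lemma jump_pair: "jump C U {\<alpha>, \<beta>} = norm (cell_value C U \<alpha> - cell_value C U \<beta>)"
  unfolding jump_def by (rule the_equality) (auto simp: doubleton_eq_iff norm_minus_commute)

lemma edges_between_cells:
  "edges \<Delta> C = {{\<alpha>, \<beta>} | \<alpha> \<beta>. \<alpha> \<in> cells \<and> \<beta> \<in> cells \<and> \<alpha> \<noteq> \<beta> \<and>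
      hausdorff_measure (CARD('k) - 1) (interface C {\<alpha>, \<beta>}) \<noteq> 0}"
proof -
  have "C \<alpha> \<noteq> {} \<and> C \<beta> \<noteq> {}" if "hausdorff_measure (CARD('k) - 1) (interface C {\<alpha>, \<beta>}) \<noteq> 0" for \<alpha> \<beta>
    using that by (auto simp: interface_def hausdorff_measure_empty)
  then show ?thesis
    unfolding edges_def cells_def by blast
qed

text \<open>
  The sum over unordered edges is half the sum over ordered pairs: each edge has exactly two
  orientations. Other pairs contribute nothing, because the two cells coincide or the weight is zero.
\<close>

lemma TV_step: "TV \<Delta> C (step v) = tv v"
proof -
  let ?S = "{p \<in> cells \<times> cells. {fst p, snd p} \<in> edges \<Delta> C}"
  let ?h = "\<lambda>(\<alpha>, \<beta>). area \<alpha> \<beta> * norm (v \<alpha> - v \<beta>)"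
  let ?w = "\<lambda>e. jump C (step v) e * enn2real (hausdorff_measure (CARD('k) - 1) (interface C e))"
  have fin: "finite ?S" "finite (edges \<Delta> C)"
    using finite_cells by (auto simp: edges_between_cells intro: finite_subset[of _ "Pow cells"])
  have fibre: "(\<Sum>p\<in>{p \<in> ?S. {fst p, snd p} = e}. ?h p) = 2 * ?w e" if e: "e \<in> edges \<Delta> C" for e
  proof -
    obtain \<alpha> \<beta> where \<alpha>\<beta>: "e = {\<alpha>, \<beta>}" "\<alpha> \<in> cells" "\<beta> \<in> cells" "\<alpha> \<noteq> \<beta>"
      using e unfolding edges_between_cells by blast
    have "{p \<in> ?S. {fst p, snd p} = e} = {(\<alpha>, \<beta>), (\<beta>, \<alpha>)}"
      using e \<alpha>\<beta> by (auto simp: doubleton_eq_iff insert_commute)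
    then show ?thesis
      using \<alpha>\<beta> by (simp add: jump_pair cell_value_step edge_weight_sym[of \<beta>] norm_minus_commute[of "v \<beta>"])
        (simp add: area_def)
  qed
  have "2 * TV \<Delta> C (step v) = (\<Sum>e\<in>edges \<Delta> C. \<Sum>p\<in>{p \<in> ?S. {fst p, snd p} = e}. ?h p)"
    unfolding TV_def sum_distrib_left by (intro sum.cong refl fibre[symmetric])
  also have "\<dots> = (\<Sum>p\<in>?S. ?h p)"
    by (rule sum.group[OF fin]) auto
  also have "\<dots> = (\<Sum>p\<in>cells \<times> cells. ?h p)"
  proof (rule sum.mono_neutral_left)
    show "\<forall>p\<in>cells \<times> cells - ?S. ?h p = 0"
      unfolding edges_between_cells by (force simp: area_def)
  qed (use finite_cells in auto)
  also have "\<dots> = 2 * tv v"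
    by (simp add: tv_def sum.cartesian_product)
  finally show ?thesis by simp
qed

text \<open>
  The supremum in the Lipschitz constant is taken over a set that is bounded above, so it dominates
  each of its quotients.
\<close>

lemma quotient_le_lip_const:
  fixes v w :: "'i \<Rightarrow> real^'l"
  assumes "step v \<noteq> step w"
  shows "\<bar>tv v - tv w\<bar> \<le>
    lip_const \<Omega> (H_space \<Omega> \<Delta> C :: (real^'k \<Rightarrow> real^'l) set) (TV \<Delta> C) * sqrt (ip (\<lambda>\<alpha>. v \<alpha> - w \<alpha>) (\<lambda>\<alpha>. v \<alpha> - w \<alpha>))"
proof -
  define K where "K = (\<Sum>\<alpha>\<in>cells. \<Sum>\<beta>\<in>cells. area \<alpha> \<beta> / sqrt (vol \<alpha>))"
  let ?q = "\<lambda>v w :: 'i \<Rightarrow> real^'l. \<bar>tv v - tv w\<bar> / sqrt (ip (\<lambda>\<alpha>. v \<alpha> - w \<alpha>) (\<lambda>\<alpha>. v \<alpha> - w \<alpha>))"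
  let ?Q = "{?q v w | v w. step v \<noteq> step w}"
  have pos: "sqrt (ip (\<lambda>\<alpha>. v \<alpha> - w \<alpha>) (\<lambda>\<alpha>. v \<alpha> - w \<alpha>)) > 0" if "step v \<noteq> step w" for v w :: "'i \<Rightarrow> real^'l"
  proof -
    obtain \<alpha> where "\<alpha> \<in> cells" "v \<alpha> - w \<alpha> \<noteq> 0"
      using \<open>step v \<noteq> step w\<close> unfolding step_eq_iff by force
    then have "ip (\<lambda>\<alpha>. v \<alpha> - w \<alpha>) (\<lambda>\<alpha>. v \<alpha> - w \<alpha>) \<noteq> 0"
      using ip_self_eq_0[of "\<lambda>\<alpha>. v \<alpha> - w \<alpha>" \<alpha>] by blast
    then show ?thesis
      using ip_self_nonneg[of "\<lambda>\<alpha>. v \<alpha> - w \<alpha>"] by simp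
  qed
  have "lip_const \<Omega> (H_space \<Omega> \<Delta> C :: (real^'k \<Rightarrow> real^'l) set) (TV \<Delta> C) = Sup ?Q"
    unfolding lip_const_def H_space_eq_range_step
  proof (rule arg_cong[where f = Sup])
    have "\<bar>TV \<Delta> C (step v) - TV \<Delta> C (step w)\<bar> / L2_norm \<Omega> (\<lambda>x. step v x - step w x) = ?q v w" for v w
      by (simp only: step_diff L2_norm_step TV_step)
    then show "{\<bar>TV \<Delta> C u - TV \<Delta> C w\<bar> / L2_norm \<Omega> (\<lambda>x. u x - w x) |u w :: real^'k \<Rightarrow> real^'l.
        u \<in> range step \<and> w \<in> range step \<and> u \<noteq> w} = ?Q"
      by (auto simp: image_iff) (metis+)
  qed
  moreover have "bdd_above ?Q"
  proof (rule bdd_aboveI)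
    fix q assume "q \<in> ?Q"
    then obtain v w where q: "q = ?q v w" "step v \<noteq> step w" by blast
    have "\<bar>tv v - tv w\<bar> \<le> tv (\<lambda>\<alpha>. v \<alpha> - w \<alpha>)"
      by (rule abs_tv_diff_le)
    also have "\<dots> \<le> K * sqrt (ip (\<lambda>\<alpha>. v \<alpha> - w \<alpha>) (\<lambda>\<alpha>. v \<alpha> - w \<alpha>))"
      unfolding K_def by (rule tv_le_const_norm)
    finally show "q \<le> K"
      using pos[OF q(2)] by (simp add: q(1) pos_divide_le_eq)
  qed
  ultimately have "?q v w \<le> lip_const \<Omega> (H_space \<Omega> \<Delta> C :: (real^'k \<Rightarrow> real^'l) set) (TV \<Delta> C)"
    using assms by (auto intro!: cSup_upper)
  then show ?thesis
    using pos[OF assms] by (simp add: pos_divide_le_eq)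
qed

section \<open>One step of the scheme\<close>

lemma TM_space_step:
  "TM_space \<Omega> \<Delta> C M (step p) = {step Z | Z. \<forall>\<alpha>\<in>cells. Z \<alpha> \<in> tangent_space M (p \<alpha>)}"
proof -
  have "(\<forall>\<alpha>\<in>\<Delta>. \<forall>x\<in>C \<alpha>. step Z x \<in> tangent_space M (step p x))
      \<longleftrightarrow> (\<forall>\<alpha>\<in>cells. Z \<alpha> \<in> tangent_space M (p \<alpha>))" for Z
    using step_eq[of _ _ Z] step_eq[of _ _ p] by (auto simp: cells_def)
  then show ?thesis
    unfolding TM_space_def H_space_eq_range_step by (auto simp: image_iff)
qed

lemma P_map_step: "P_map \<Delta> C M (step p) (step Z) = step (\<lambda>\<alpha>. orth_proj (tangent_space M (p \<alpha>)) (Z \<alpha>))"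
  by (rule step_eqI) (auto simp: P_map_def step_eq cells_def)

text \<open>
  Testing the inequality with \<open>\<zeta>\<close> itself gives \<open>\<parallel>\<zeta>\<parallel>\<^sup>2 \<le> tv \<zeta> - tv 0 \<le> Lip \<parallel>\<zeta>\<parallel>\<close>. If \<open>\<zeta> = 0\<close>, it has to be
  seen that the Lipschitz constant is nonnegative, which needs a nonzero step function.
\<close>

lemma subgradient_norm_le_lip_const:
  fixes \<zeta> :: "'i \<Rightarrow> real^'l"
  assumes "\<And>w. ip \<zeta> w \<le> tv w"
  shows "sqrt (ip \<zeta> \<zeta>) \<le> lip_const \<Omega> (H_space \<Omega> \<Delta> C :: (real^'k \<Rightarrow> real^'l) set) (TV \<Delta> C)"
    (is "_ \<le> ?Lip")
proof (cases "ip \<zeta> \<zeta> = 0")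
  case True
  obtain \<alpha> where \<alpha>: "\<alpha> \<in> cells"
    using cells_nonempty by blast
  obtain e :: "real^'l" where e: "e \<noteq> 0"
    using that[of "axis undefined 1"] by (simp add: axis_eq_0_iff)
  have "0 \<le> ?Lip"
  proof (rule ccontr)
    assume neg: "\<not> 0 \<le> ?Lip"
    have ne: "step (\<lambda>_. e) \<noteq> step (\<lambda>_. 0)"
      using \<alpha> e by (auto simp: step_eq_iff)
    have "ip (\<lambda>_. e) (\<lambda>_. e) > 0"
      using ip_self_eq_0[of "\<lambda>_. e" \<alpha>] ip_self_nonneg[of "\<lambda>_. e"] \<alpha> e by fastforce
    then have "?Lip * sqrt (ip (\<lambda>_. e) (\<lambda>_. e)) < 0"
      using neg by (simp add: mult_less_0_iff)
    then show False
      using quotient_le_lip_const[OF ne] by simp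
  qed
  with True show ?thesis by simp
next
  case False
  then have pos: "ip \<zeta> \<zeta> > 0"
    using ip_self_nonneg[of \<zeta>] by simp
  have "step \<zeta> \<noteq> step (\<lambda>_. 0)"
  proof
    assume "step \<zeta> = step (\<lambda>_. 0)"
    then have "ip \<zeta> \<zeta> = 0"
      by (simp add: step_eq_iff ip_def)
    with False show False ..
  qed
  then have "\<bar>tv \<zeta> - tv (\<lambda>_. 0 :: real^'l)\<bar> \<le> ?Lip * sqrt (ip \<zeta> \<zeta>)"
    using quotient_le_lip_const[of \<zeta> "\<lambda>_. 0"] by simp
  moreover have "sqrt (ip \<zeta> \<zeta>) * sqrt (ip \<zeta> \<zeta>) \<le> tv \<zeta>"
    using assms[of \<zeta>] pos by simp
  ultimately have "sqrt (ip \<zeta> \<zeta>) * sqrt (ip \<zeta> \<zeta>) \<le> ?Lip * sqrt (ip \<zeta> \<zeta>)"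
    by (simp add: tv_def)
  then show ?thesis
    by (rule mult_right_le_imp_le) (use pos in simp)
qed

text \<open>
  The tangential projection \<open>X = - \<tau> P \<zeta>\<close> of the subgradient provided by the dual problem is the
  minimiser: since \<open>Z - X\<close> is tangential, \<open>\<tau> \<langle>\<zeta>, Z - X\<rangle> = - \<langle>X, Z - X\<rangle>\<close>, and this turns the subgradient
  inequality into quadratic growth of the objective around \<open>X\<close>.
\<close>

lemma step_minimizer_characterization:
  fixes u :: "real^'k \<Rightarrow> real^'l"
  assumes u: "u \<in> M_space \<Omega> \<Delta> C M" and M: "C2_submanifold M" and \<tau>: "\<tau> > 0"
  defines "H \<equiv> (H_space \<Omega> \<Delta> C :: (real^'k \<Rightarrow> real^'l) set)"
  obtains X where "\<And>Y. step_minimizer \<Omega> \<Delta> C M \<tau> u Y \<longleftrightarrow> Y = X"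
    and "X \<in> (\<lambda>\<zeta> x. - \<tau> *\<^sub>R P_map \<Delta> C M u \<zeta> x) ` subdifferential \<Omega> H (TV \<Delta> C) (\<lambda>x. u x + X x)"
    and "L2_norm \<Omega> X \<le> \<tau> * lip_const \<Omega> H (TV \<Delta> C)"
proof -
  obtain p where p: "u = step p"
    using u unfolding M_space_def H_space_eq_range_step by blast
  define V where "V = (\<lambda>\<alpha>. tangent_space M (p \<alpha>))"
  have "p \<alpha> \<in> M" if "\<alpha> \<in> cells" for \<alpha>
    using u that step_eq[of \<alpha> _ p] unfolding p M_space_def cells_def by force
  then have V: "subspace (V \<alpha>)" if "\<alpha> \<in> cells" for \<alpha>
    using subspace_tangent_space[OF M] that by (simp add: V_def)
  obtain \<zeta> where \<zeta>: "\<And>w. ip \<zeta> w \<le> tv w"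
    and eq: "ip \<zeta> (\<lambda>\<alpha>. p \<alpha> - \<tau> *\<^sub>R orth_proj (V \<alpha>) (\<zeta> \<alpha>))
      = tv (\<lambda>\<alpha>. p \<alpha> - \<tau> *\<^sub>R orth_proj (V \<alpha>) (\<zeta> \<alpha>))"
    using exists_subgradient_along[of V p \<tau>] V by blast
  define Pz where "Pz = (\<lambda>\<alpha>. orth_proj (V \<alpha>) (\<zeta> \<alpha>))"
  define X where "X = (\<lambda>\<alpha>. - \<tau> *\<^sub>R Pz \<alpha>)"
  have X_V: "X \<alpha> \<in> V \<alpha>" if "\<alpha> \<in> cells" for \<alpha>
    using V[OF that] by (simp add: X_def Pz_def orth_proj_decomposition subspace_neg subspace_scale)
  have subgrad: "ip \<zeta> (\<lambda>\<alpha>. w \<alpha> - (p \<alpha> + X \<alpha>)) + tv (\<lambda>\<alpha>. p \<alpha> + X \<alpha>) \<le> tv w" for w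
    using \<zeta>[of w] eq by (simp add: X_def Pz_def ip_diff_right)
  define J where "J = (\<lambda>Z. \<tau> * TV \<Delta> C (\<lambda>x. u x + Z x) + 1 / 2 * (L2_norm \<Omega> Z)\<^sup>2)"
  have J: "J (step Z) = \<tau> * tv (\<lambda>\<alpha>. p \<alpha> + Z \<alpha>) + 1 / 2 * ip Z Z" for Z
    by (simp add: J_def p step_add TV_step L2_norm_step ip_self_nonneg)
  have growth: "J (step X) + 1 / 2 * ip (\<lambda>\<alpha>. Z \<alpha> - X \<alpha>) (\<lambda>\<alpha>. Z \<alpha> - X \<alpha>) \<le> J (step Z)"
    if Z: "\<And>\<alpha>. \<alpha> \<in> cells \<Longrightarrow> Z \<alpha> \<in> V \<alpha>" for Z
  proof -
    have "ip \<zeta> (\<lambda>\<alpha>. Z \<alpha> - X \<alpha>) = ip Pz (\<lambda>\<alpha>. Z \<alpha> - X \<alpha>)"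
      unfolding ip_def Pz_def using V Z X_V
      by (intro sum.cong refl) (simp add: orth_proj_inner subspace_diff)
    then have "\<tau> * ip \<zeta> (\<lambda>\<alpha>. Z \<alpha> - X \<alpha>) = - ip X (\<lambda>\<alpha>. Z \<alpha> - X \<alpha>)"
      unfolding X_def by (simp only: ip_scale_left)
    moreover have "\<tau> * (ip \<zeta> (\<lambda>\<alpha>. Z \<alpha> - X \<alpha>) + tv (\<lambda>\<alpha>. p \<alpha> + X \<alpha>)) \<le> \<tau> * tv (\<lambda>\<alpha>. p \<alpha> + Z \<alpha>)"
      using subgrad[of "\<lambda>\<alpha>. p \<alpha> + Z \<alpha>"] \<tau> by simp
    ultimately show ?thesis
      by (simp add: J ip_diff_left ip_diff_right ip_commute[of Z X] field_simps)
  qed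
  show thesis
  proof (rule that[of "step X"])
    have X_TM: "step X \<in> TM_space \<Omega> \<Delta> C M u"
      using X_V unfolding p TM_space_step V_def by blast
    have le: "J (step X) \<le> J Y" if "Y \<in> TM_space \<Omega> \<Delta> C M u" for Y
    proof -
      obtain Z where Z: "Y = step Z" "\<And>\<alpha>. \<alpha> \<in> cells \<Longrightarrow> Z \<alpha> \<in> V \<alpha>"
        using \<open>Y \<in> TM_space \<Omega> \<Delta> C M u\<close> unfolding p TM_space_step V_def by blast
      then show ?thesis
        using growth[of Z] ip_self_nonneg[of "\<lambda>\<alpha>. Z \<alpha> - X \<alpha>"] by simp
    qed
    have eq_X: "Y = step X" if "Y \<in> TM_space \<Omega> \<Delta> C M u" "J Y \<le> J (step X)" for Y
    proof -
      obtain Z where Z: "Y = step Z" "\<And>\<alpha>. \<alpha> \<in> cells \<Longrightarrow> Z \<alpha> \<in> V \<alpha>"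
        using \<open>Y \<in> TM_space \<Omega> \<Delta> C M u\<close> unfolding p TM_space_step V_def by blast
      then have "ip (\<lambda>\<alpha>. Z \<alpha> - X \<alpha>) (\<lambda>\<alpha>. Z \<alpha> - X \<alpha>) = 0"
        using growth[of Z] that(2) ip_self_nonneg[of "\<lambda>\<alpha>. Z \<alpha> - X \<alpha>"] by simp
      then have "Z \<alpha> - X \<alpha> = 0" if "\<alpha> \<in> cells" for \<alpha>
        using ip_self_eq_0[of "\<lambda>\<alpha>. Z \<alpha> - X \<alpha>" \<alpha>] that by blast
      then show ?thesis
        by (simp add: Z(1) step_eq_iff)
    qed
    show "step_minimizer \<Omega> \<Delta> C M \<tau> u Y \<longleftrightarrow> Y = step X" for Y
      unfolding step_minimizer_def is_arg_min_linorder J_def[symmetric]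
      using X_TM le eq_X by blast
    have subdiff: "step \<zeta> \<in> subdifferential \<Omega> H (TV \<Delta> C) (\<lambda>x. u x + step X x)"
      unfolding subdifferential_def H_def H_space_eq_range_step p step_add
      using subgrad by (auto simp: step_diff L2_inner_step TV_step)
    have "step X = (\<lambda>x. - \<tau> *\<^sub>R P_map \<Delta> C M u (step \<zeta>) x)"
      unfolding p P_map_step V_def[symmetric]
      by (rule step_eqI[symmetric]) (auto simp: X_def Pz_def V_def step_eq step_eq_0 cells_def)
    then show "step X \<in> (\<lambda>\<zeta> x. - \<tau> *\<^sub>R P_map \<Delta> C M u \<zeta> x) `
        subdifferential \<Omega> H (TV \<Delta> C) (\<lambda>x. u x + step X x)"
      by (rule image_eqI[where x = "step \<zeta>"]) (rule subdiff)
    have "ip Pz Pz \<le> ip \<zeta> \<zeta>"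
    proof -
      have "Pz \<alpha> \<bullet> Pz \<alpha> \<le> \<zeta> \<alpha> \<bullet> \<zeta> \<alpha>" if "\<alpha> \<in> cells" for \<alpha>
        using norm_orth_proj_le[OF V[OF that]] unfolding Pz_def norm_le[symmetric] by blast
      then show ?thesis
        unfolding ip_def using vol_pos by (intro sum_mono mult_left_mono) (simp_all add: less_imp_le)
    qed
    then have "sqrt (ip Pz Pz) \<le> lip_const \<Omega> H (TV \<Delta> C)"
      using subgradient_norm_le_lip_const[OF \<zeta>] unfolding H_def
      by (meson order_trans real_sqrt_le_mono)
    moreover have "L2_norm \<Omega> (step X) = \<tau> * sqrt (ip Pz Pz)"
      using \<tau> unfolding L2_norm_step X_def ip_scale_left ip_scale_right
      by (simp add: real_sqrt_mult flip: mult.assoc)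
    ultimately show "L2_norm \<Omega> (step X) \<le> \<tau> * lip_const \<Omega> H (TV \<Delta> C)"
      using \<tau> by simp
  qed
qed

text \<open>
  Uniqueness of geodesics makes the value of the exponential map the time-one point of a geodesic, which
  lies on \<open>M\<close>.
\<close>

lemma Exp_map_in_M_space:
  assumes u: "u \<in> M_space \<Omega> \<Delta> C M" and "unique_geodesics M" and X: "X \<in> TM_space \<Omega> \<Delta> C M u"
  shows "Exp_map \<Delta> C M u X \<in> M_space \<Omega> \<Delta> C M"
proof -
  obtain p where p: "u = step p"
    using u unfolding M_space_def H_space_eq_range_step by blast
  obtain Z where Z: "X = step Z" "\<And>\<alpha>. \<alpha> \<in> cells \<Longrightarrow> Z \<alpha> \<in> tangent_space M (p \<alpha>)"
    using X unfolding p TM_space_step by blast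
  have Exp: "Exp_map \<Delta> C M u X = step (\<lambda>\<alpha>. exp_map M (p \<alpha>) (Z \<alpha>))"
    unfolding p Z(1) by (rule step_eqI) (auto simp: Exp_map_def step_eq cells_def)
  have "exp_map M (p \<alpha>) (Z \<alpha>) \<in> M" if "\<alpha> \<in> \<Delta>" "x \<in> C \<alpha>" for \<alpha> x
  proof -
    have \<alpha>: "\<alpha> \<in> cells"
      using that by (auto simp: cells_def)
    moreover have "p \<alpha> \<in> M"
      using u that step_eq[of \<alpha> x p] unfolding p M_space_def by force
    ultimately obtain \<gamma> where \<gamma>: "geodesic M (p \<alpha>) (Z \<alpha>) \<gamma>"
      and unique: "\<And>\<gamma>'. geodesic M (p \<alpha>) (Z \<alpha>) \<gamma>' \<Longrightarrow> \<forall>t\<ge>0. \<gamma>' t = \<gamma> t"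
      using \<open>unique_geodesics M\<close> Z(2) unfolding unique_geodesics_def by metis
    have "exp_map M (p \<alpha>) (Z \<alpha>) = \<gamma> 1"
      unfolding exp_map_def
    proof (rule the_equality)
      show "\<exists>\<gamma>'. geodesic M (p \<alpha>) (Z \<alpha>) \<gamma>' \<and> \<gamma> 1 = \<gamma>' 1"
        using \<gamma> by blast
      show "q = \<gamma> 1" if "\<exists>\<gamma>'. geodesic M (p \<alpha>) (Z \<alpha>) \<gamma>' \<and> q = \<gamma>' 1" for q
        using that unique zero_le_one by blast
    qed
    moreover have "\<gamma> 1 \<in> M"
      using \<gamma> unfolding geodesic_def by simp
    ultimately show ?thesis by simp
  qed
  then show ?thesis
    unfolding Exp M_space_def by (simp add: step_in_H_space step_eq)
qed

end

section \<open>The scheme\<close>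

theorem proposition3:
  fixes \<Omega> :: "(real^'k) set"
    and \<Delta> :: "'i set"
    and C :: "'i \<Rightarrow> (real^'k) set"
    and M :: "(real^'l) set"
    and T \<tau> :: real
    and u\<^sub>0 :: "real^'k \<Rightarrow> real^'l"
  assumes "bounded_lipschitz_domain \<Omega>"
    and "rectangular_partition \<Omega> \<Delta> C"
    and "CARD('l) \<ge> 2"
    and "compact M" and "C2_submanifold M"
    and "unique_geodesics M"
    and "T > 0" and "\<tau> > 0"
    and "u\<^sub>0 \<in> M_space \<Omega> \<Delta> C M"
  defines "u \<equiv> MM_u \<Omega> \<Delta> C M \<tau> u\<^sub>0"
    and "X \<equiv> MM_X \<Omega> \<Delta> C M \<tau> u\<^sub>0"
    and "N \<equiv> num_steps T \<tau>"
    and "H \<equiv> (H_space \<Omega> \<Delta> C :: (real^'k \<Rightarrow> real^'l) set)"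
  shows "(\<forall>n\<le>N. u n \<in> M_space \<Omega> \<Delta> C M) \<and>
    (\<forall>n<N.
      (\<exists>!Y. step_minimizer \<Omega> \<Delta> C M \<tau> (u n) Y) \<and>
      step_minimizer \<Omega> \<Delta> C M \<tau> (u n) (X n) \<and>
      X n \<in> (\<lambda>\<zeta> x. - \<tau> *\<^sub>R P_map \<Delta> C M (u n) \<zeta> x) `
               subdifferential \<Omega> H (TV \<Delta> C) (\<lambda>x. u n x + X n x) \<and>
      L2_norm \<Omega> (X n) \<le> \<tau> * lip_const \<Omega> H (TV \<Delta> C))"
proof -
  interpret rectangular_cells \<Omega> \<Delta> C
    using assms(1,2) by unfold_locales (auto simp: bounded_lipschitz_domain_def)
  have X_n: "(\<forall>Y. step_minimizer \<Omega> \<Delta> C M \<tau> (u n) Y \<longleftrightarrow> Y = X n) \<and>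
      X n \<in> (\<lambda>\<zeta> x. - \<tau> *\<^sub>R P_map \<Delta> C M (u n) \<zeta> x) `
               subdifferential \<Omega> H (TV \<Delta> C) (\<lambda>x. u n x + X n x) \<and>
      L2_norm \<Omega> (X n) \<le> \<tau> * lip_const \<Omega> H (TV \<Delta> C)"
    if u_n: "u n \<in> M_space \<Omega> \<Delta> C M" for n
  proof -
    obtain Y where Y: "\<And>Y'. step_minimizer \<Omega> \<Delta> C M \<tau> (u n) Y' \<longleftrightarrow> Y' = Y"
      "Y \<in> (\<lambda>\<zeta> x. - \<tau> *\<^sub>R P_map \<Delta> C M (u n) \<zeta> x) `
               subdifferential \<Omega> H (TV \<Delta> C) (\<lambda>x. u n x + Y x)"
      "L2_norm \<Omega> Y \<le> \<tau> * lip_const \<Omega> H (TV \<Delta> C)"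
      unfolding H_def
      using step_minimizer_characterization[OF u_n \<open>C2_submanifold M\<close> \<open>\<tau> > 0\<close>] by blast
    have "X n = Y"
      by (simp add: X_def MM_X_def MM_step_def Y(1) flip: u_def)
    show ?thesis
      unfolding \<open>X n = Y\<close> using Y by blast
  qed
  have u_n: "u n \<in> M_space \<Omega> \<Delta> C M" for n
  proof (induction n)
    case 0
    then show ?case using assms(9) by (simp add: u_def)
  next
    case (Suc n)
    have "X n \<in> TM_space \<Omega> \<Delta> C M (u n)"
      using X_n[OF Suc] unfolding step_minimizer_def is_arg_min_def by blast
    moreover have "u (Suc n) = Exp_map \<Delta> C M (u n) (X n)"
      by (simp add: u_def X_def MM_X_def)
    ultimately show ?case
      using Exp_map_in_M_space[OF Suc \<open>unique_geodesics M\<close>] by simp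
  qed
  show ?thesis
    using u_n X_n[OF u_n] by simp
qed

end
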